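(* Fix integers $k,M,r\geq 1$. Let $\mathcal{Y}$ be a $k$-regular strongly-connected Ramanujan digraph on $n$ vertices whose adjacency matrix $A_{\mathcal{Y}}$ has period $M$ and is $r$-normal. Then for every vertex $x$, for all but $o(n)$ of the vertices $y$ there is a directed path of length at most $\log_k n+(2r-1+o(1))\log_k\log n$ from $x$ to $y$, and such a path from $y$ to $x$. In particular, $\operatorname{diam}(\mathcal{Y})\leq(2+o(1))\log_k n$.
   Context: A digraph is $k$-regular if every vertex has in-degree and out-degree $k$. A finite $k$-out-regular digraph is Ramanujan if every eigenvalue $\lambda\in\mathbb{C}$ of its adjacency matrix satisfies $|\lambda|\le\sqrt{k}$ or $|\lambda|=k$. The period of a strongly connected digraph is the gcd of the lengths of its directed cycles. A matrix is $r$-normal if it is unitarily similar to a block-diagonal matrix each of whose blocks has size at most $r$. Asymptotic notation refers to $n\to\infty$ with $k,M,r$ fixed. *)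

theory Defs
  imports
    "HOL-Library.Landau_Symbols"
    "Graph_Theory.Digraph_Component"
    "Graph_Theory.Shortest_Path"
    "Jordan_Normal_Form.Schur_Decomposition"
begin

text \<open>
  Digraphs are those of the locale \<^locale>\<open>fin_digraph\<close>: finite, with loops and parallel
  arcs allowed. The adjacency matrix counts arcs with multiplicity.
\<close>

(* Everything below that refers to the adjacency matrix is invariant under simultaneous
   permutation of rows and columns, so the choice of the enumeration is immaterial. *)
definition vertex_list :: "('v, 'e) pre_digraph \<Rightarrow> 'v list" where
  "vertex_list G = (SOME vs. distinct vs \<and> set vs = verts G)"

definition adjacency_matrix :: "('v, 'e) pre_digraph \<Rightarrow> complex mat" where
  "adjacency_matrix G = mat (card (verts G)) (card (verts G))
     (\<lambda>(i, j). of_nat (card {e \<in> arcs G.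
        tail G e = vertex_list G ! i \<and> head G e = vertex_list G ! j}))"

definition out_regular :: "nat \<Rightarrow> ('v, 'e) pre_digraph \<Rightarrow> bool" where
  "out_regular k G \<longleftrightarrow> (\<forall>v \<in> verts G. out_degree G v = k)"

definition regular_digraph :: "nat \<Rightarrow> ('v, 'e) pre_digraph \<Rightarrow> bool" where
  "regular_digraph k G \<longleftrightarrow> (\<forall>v \<in> verts G. in_degree G v = k \<and> out_degree G v = k)"

definition ramanujan_digraph :: "nat \<Rightarrow> ('v, 'e) pre_digraph \<Rightarrow> bool" where
  "ramanujan_digraph k G \<longleftrightarrow> fin_digraph G \<and> out_regular k G \<and>
     (\<forall>l::complex. eigenvalue (adjacency_matrix G) l \<longrightarrow> cmod l \<le> sqrt (real k) \<or> cmod l = real k)"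

definition period :: "('v, 'e) pre_digraph \<Rightarrow> nat" where
  "period G = Gcd {length p | p. pre_digraph.cycle G p}"

(* similar_mat_wit contains the unitarity of U: it requires the two matrices
   U and mat_adjoint U to be inverse to each other. *)
definition unitarily_similar :: "complex mat \<Rightarrow> complex mat \<Rightarrow> bool" where
  "unitarily_similar A B \<longleftrightarrow> (\<exists>U. similar_mat_wit A B U (mat_adjoint U))"

definition r_normal :: "nat \<Rightarrow> complex mat \<Rightarrow> bool" where
  "r_normal r A \<longleftrightarrow> (\<exists>Bs. (\<forall>B \<in> set Bs. square_mat B \<and> dim_row B \<le> r) \<and>
     unitarily_similar A (diag_block_mat Bs))"

(* The distance is the library's shortest walk cost, all arcs having weight 1. *)
definition diam :: "('v, 'e) pre_digraph \<Rightarrow> ereal" where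
  "diam G = (SUP u \<in> verts G. SUP v \<in> verts G. wf_digraph.\<mu> G (\<lambda>_. 1) u v)"

definition path_within :: "('v, 'e) pre_digraph \<Rightarrow> real \<Rightarrow> 'v \<Rightarrow> 'v \<Rightarrow> bool" where
  "path_within G L u v \<longleftrightarrow> (\<exists>p. pre_digraph.apath G u p v \<and> real (length p) \<le> L)"

end

theory Submission
  imports Defs "Jordan_Normal_Form.Spectral_Radius" "HOL-Analysis.L2_Norm"
begin

text \<open>
  Triangularizing the blocks of an \<open>r\<close>-normal form unitarily gives \<open>A = U T U\<^sup>*\<close>, where \<open>T\<close> is
  upper triangular with blocks of size at most \<open>r\<close>. Since \<open>\<parallel>A\<parallel> \<le> k\<close>, a diagonal entry of \<open>T\<close> of
  modulus \<open>k\<close> is alone in its row and column, so that \<open>T\<close> splits into a diagonal part carrying the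
  eigenvalues of modulus \<open>k\<close> and a part whose \<open>l\<close>-th power has entries
  \<open>O(l\<^bsup>r-1\<^esup> k\<^bsup>l/2\<^esup>)\<close> by the Ramanujan bound.
  Equality in the triangle inequality along arcs shows that an eigenvalue \<open>\<lambda>\<close> of modulus \<open>k\<close>
  satisfies \<open>(\<lambda>/k)\<^sup>M = 1\<close> and that the eigenvectors for \<open>k\<close> itself are constant. Hence the average
  \<open>\<Sum>i<M. A\<^bsup>l+i\<^esup> / k\<^sup>i\<close> annihilates all eigenvectors for \<open>\<lambda> \<noteq> k\<close> of modulus \<open>k\<close>, and equals
  \<open>M k\<^sup>l / n\<close> times the all-ones matrix, up to the multiplicity of \<open>k\<close>, plus an error whose rows and columns have norm
  \<open>O(l\<^bsup>r-1\<^esup> k\<^bsup>l/2\<^esup>)\<close>. A vertex not reached contributes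
  \<open>(M k\<^sup>l / n)\<^sup>2\<close> to the squared norm of a row of the error, so at most
  \<open>O(l\<^bsup>2r-2\<^esup> n\<^sup>2 / k\<^sup>l)\<close> vertices are missed; for the given \<open>l\<close> this is
  \<open>O(n / log n)\<close>. For the diameter, the vertices reached from \<open>x\<close> and those reaching \<open>y\<close> overlap.
  The case \<open>k = 1\<close> is vacuous for large \<open>n\<close>, the graph being a cycle of length \<open>n = M\<close>.
\<close>

section \<open>Unitary block triangularization\<close>

lemma mat_adjoint_carrier [simp]: "A \<in> carrier_mat n m \<Longrightarrow> mat_adjoint A \<in> carrier_mat m n"
  by (auto simp: mat_adjoint_def mat_of_rows_def)

lemma mat_adjoint_index [simp]:
  fixes A :: "complex mat"
  assumes "i < dim_col A" "j < dim_row A"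
  shows "mat_adjoint A $$ (i, j) = cnj (A $$ (j, i))"
  using assms by (simp add: mat_adjoint_def mat_of_rows_def)

lemma dim_mat_adjoint [simp]:
  "dim_row (mat_adjoint A) = dim_col A" "dim_col (mat_adjoint A) = dim_row A"
  by (simp_all add: mat_adjoint_def mat_of_rows_def)

lemma mat_adjoint_mult:
  fixes A B :: "complex mat"
  assumes "A \<in> carrier_mat n m" "B \<in> carrier_mat m l"
  shows "mat_adjoint (A * B) = mat_adjoint B * mat_adjoint A"
  using assms by (intro eq_matI) (auto simp: scalar_prod_def mult.commute)

lemma mat_adjoint_adjoint [simp]: "mat_adjoint (mat_adjoint A) = (A :: complex mat)"
  by (intro eq_matI) auto

lemma mat_adjoint_one [simp]: "mat_adjoint (1\<^sub>m n :: complex mat) = 1\<^sub>m n"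
  by (intro eq_matI) auto

lemma mat_adjoint_diag_blocks:
  fixes A B :: "complex mat"
  assumes "A \<in> carrier_mat n n" "B \<in> carrier_mat m m"
  shows "mat_adjoint (four_block_mat A (0\<^sub>m n m) (0\<^sub>m m n) B)
    = four_block_mat (mat_adjoint A) (0\<^sub>m n m) (0\<^sub>m m n) (mat_adjoint B)"
  using assms by (intro eq_matI) (auto simp: four_block_mat_def Let_def)

text \<open>Gram-Schmidt on a basis that starts with \<open>v\<close> keeps \<open>v\<close> in
  front; dividing each vector by its norm yields unitary columns. Only the direction of the first
  column matters, so the scalar \<open>c\<close> stays unspecified.\<close>

lemma exists_unitary_with_first_column:
  fixes v :: "complex vec"
  assumes v: "v \<in> carrier_vec n" and v0: "v \<noteq> 0\<^sub>v n"
  obtains W c where "W \<in> carrier_mat n n" "mat_adjoint W * W = 1\<^sub>m n" "W * mat_adjoint W = 1\<^sub>m n"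
    "col W 0 = c \<cdot>\<^sub>v v"
proof -
  interpret cof_vec_space n "TYPE(complex)" .
  define b where "b = basis_completion v"
  define ws where "ws = gram_schmidt n b"
  have n: "n > 0" using v v0 by (cases n) auto
  from basis_completion[OF v v0, folded b_def]
  have dist_b: "distinct b" and indep: "\<not> lin_dep (set b)" and b: "set b \<subseteq> carrier_vec n"
    and hdb: "hd b = v" and len_b: "length b = n" by auto
  from hdb len_b n obtain vs where bv: "b = v # vs" by (cases b, auto)
  from gram_schmidt_result[OF b dist_b indep refl, folded ws_def]
  have ws: "set ws \<subseteq> carrier_vec n" "corthogonal ws" "length ws = n"
    by (auto simp: len_b)
  from gram_schmidt_hd[OF v, of vs, folded bv] have "hd ws = v" unfolding ws_def .
  then have ws0: "ws ! 0 = v" using ws n by (metis hd_conv_nth length_0_conv less_numeral_extra(3))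
  have wsi: "ws ! i \<in> carrier_vec n" if "i < n" for i using ws that by auto
  define N where "N i = (\<Sum>k<n. (cmod (ws ! i $ k))\<^sup>2)" for i
  have sq: "(ws ! j) \<bullet>c (ws ! i) = (\<Sum>k<n. cnj (ws ! i $ k) * ws ! j $ k)" if "i < n" "j < n" for i j
    using wsi[OF that(1)] wsi[OF that(2)] by (auto simp: scalar_prod_def lessThan_atLeast0 mult.commute)
  have N: "(ws ! i) \<bullet>c (ws ! i) = of_real (N i)" if "i < n" for i
    unfolding sq[OF that that] N_def of_real_sum
    by (intro sum.cong) (auto simp: complex_norm_square simp flip: of_real_power)
  have N0: "N i > 0" if "i < n" for i
  proof -
    have "N i \<ge> 0" unfolding N_def by (intro sum_nonneg) auto
    moreover have "N i \<noteq> 0" using N[OF that] corthogonalD[OF ws(2), of i i] that ws(3) by auto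
    ultimately show ?thesis by simp
  qed
  define W where "W = mat n n (\<lambda>(i, j). ws ! j $ i / of_real (sqrt (N j)))"
  have W: "W \<in> carrier_mat n n" unfolding W_def by auto
  have "mat_adjoint W * W = 1\<^sub>m n"
  proof (intro eq_matI)
    fix i j assume "i < dim_row (1\<^sub>m n :: complex mat)" "j < dim_col (1\<^sub>m n :: complex mat)"
    then have ij: "i < n" "j < n" by auto
    have "(mat_adjoint W * W) $$ (i, j) = (\<Sum>k<n. cnj (W $$ (k, i)) * W $$ (k, j))"
      using ij W by (auto simp: scalar_prod_def lessThan_atLeast0)
    also have "\<dots> = ((ws ! j) \<bullet>c (ws ! i)) / (of_real (sqrt (N i)) * of_real (sqrt (N j)))"
      unfolding sq[OF ij] W_def using ij by (simp add: sum_divide_distrib)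
    also have "\<dots> = 1\<^sub>m n $$ (i, j)"
    proof (cases "i = j")
      case True
      then show ?thesis using N[OF ij(1)] N0[OF ij(1)] ij
        by (simp flip: of_real_mult of_real_divide)
    next
      case False
      then show ?thesis using corthogonalD[OF ws(2), of j i] ij ws(3) by auto
    qed
    finally show "(mat_adjoint W * W) $$ (i, j) = 1\<^sub>m n $$ (i, j)" .
  qed (use W in auto)
  moreover from mat_mult_left_right_inverse[OF _ W this] W
  have "W * mat_adjoint W = 1\<^sub>m n" by auto
  moreover have "col W 0 = (1 / of_real (sqrt (N 0))) \<cdot>\<^sub>v v"
    using v ws0 n by (intro eq_vecI) (auto simp: W_def)
  ultimately show ?thesis using that W by blast
qed

text \<open>Conjugation by a block-diagonal unitary changes the coupling block \<open>C\<close> but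
  keeps the zero block below it. Used with general \<open>C\<close> for deflation and with
  \<open>C = 0\<close> to put independent blocks together.\<close>

lemma similar_mat_wit_adjoint_four_block:
  fixes A B :: "complex mat"
  assumes A: "similar_mat_wit A A' U (mat_adjoint U)" "A \<in> carrier_mat n n"
    and B: "similar_mat_wit B B' V (mat_adjoint V)" "B \<in> carrier_mat m m"
    and C: "C \<in> carrier_mat n m"
  defines "W \<equiv> four_block_mat U (0\<^sub>m n m) (0\<^sub>m m n) V"
  shows "similar_mat_wit (four_block_mat A C (0\<^sub>m m n) B)
     (four_block_mat A' (mat_adjoint U * C * V) (0\<^sub>m m n) B') W (mat_adjoint W)"
proof -
  note a = similar_mat_witD2[OF A(2,1)]
  note b = similar_mat_witD2[OF B(2,1)]
  have "U * (mat_adjoint U * C * V) = (U * (mat_adjoint U * C)) * V"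
    by (rule assoc_mult_mat[symmetric, of _ n n _ m _ m]) (use a(6,7) b(6) C in auto)
  also have "U * (mat_adjoint U * C) = (U * mat_adjoint U) * C"
    by (rule assoc_mult_mat[symmetric, of _ n n _ n _ m]) (use a(6,7) C in auto)
  also have "\<dots> = C" using a(1) C by simp
  finally have "U * (mat_adjoint U * C * V) * mat_adjoint V = C * V * mat_adjoint V" by simp
  also have "\<dots> = C * (V * mat_adjoint V)"
    by (rule assoc_mult_mat[of _ n m _ m _ m]) (use b(6,7) C in auto)
  also have "\<dots> = C" using b(1) C by simp
  finally have eq: "U * (mat_adjoint U * C * V) * mat_adjoint V = C" .
  show ?thesis
    unfolding W_def mat_adjoint_diag_blocks[OF a(6) b(6)]
    using a(6,7) b(6,7) C
    by (intro similar_mat_wit_four_block[OF A(1) B(1) eq[symmetric] _ A(2) B(2)]) auto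
qed

text \<open>Schur's theorem by deflation: a unitary whose first column is an eigenvector clears the
  first column below the diagonal, and the induction hypothesis treats the remaining
  \<open>m\<close> by \<open>m\<close> block.\<close>

theorem unitary_triangularization:
  fixes A :: "complex mat"
  assumes "A \<in> carrier_mat n n"
  shows "\<exists>T U. similar_mat_wit A T U (mat_adjoint U) \<and> upper_triangular T"
  using assms
proof (induction n arbitrary: A)
  case 0
  then show ?case
    by (intro exI[of _ A] exI[of _ "1\<^sub>m 0"]) (auto intro: similar_mat_wit_refl)
next
  case (Suc m)
  let ?n = "Suc m"
  note A = Suc.prems
  obtain e where "eigenvalue A e" using spectrum_non_empty[OF A] by (auto simp: spectrum_def)
  then obtain v where "eigenvector A v e" unfolding eigenvalue_def by auto
  with A have v: "v \<in> carrier_vec ?n" "v \<noteq> 0\<^sub>v ?n" and Av: "A *\<^sub>v v = e \<cdot>\<^sub>v v"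
    unfolding eigenvector_def by auto
  obtain W c where W: "W \<in> carrier_mat ?n ?n" "mat_adjoint W * W = 1\<^sub>m ?n"
    "W * mat_adjoint W = 1\<^sub>m ?n" and col: "col W 0 = c \<cdot>\<^sub>v v"
    using exists_unitary_with_first_column[OF v] by metis
  have colW: "col W 0 \<in> carrier_vec ?n" using W(1) by (intro carrier_vecI) simp
  define A' where "A' = mat_adjoint W * A * W"
  have A': "A' \<in> carrier_mat ?n ?n" unfolding A'_def using A W(1) by auto
  have "similar_mat_wit A' A (mat_adjoint W) W"
    using A A' W by (intro similar_mat_witI[of _ _ ?n]) (auto simp: A'_def)
  then have AA': "similar_mat_wit A A' W (mat_adjoint W)" by (rule similar_mat_wit_sym)
  \<comment> \<open>The first column of \<open>W\<close> is an eigenvector of \<open>A\<close>, and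
    the adjoint of \<open>W\<close> sends it to the first unit vector.\<close>
  have A'0: "A' $$ (i, 0) = (if i = 0 then e else 0)" if "i < ?n" for i
  proof -
    have "col A' 0 = mat_adjoint W *\<^sub>v (A *\<^sub>v col W 0)"
      unfolding A'_def using A W(1) colW
      by (subst col_mult2[of _ ?n ?n _ ?n], auto intro!: assoc_mult_mat_vec[of _ ?n ?n _ ?n])
    also have "A *\<^sub>v col W 0 = e \<cdot>\<^sub>v col W 0"
      unfolding col using A v Av by (simp add: mult_mat_vec smult_smult_assoc mult.commute)
    also have "mat_adjoint W *\<^sub>v \<dots> = e \<cdot>\<^sub>v (mat_adjoint W *\<^sub>v col W 0)"
      using W(1) colW by (intro mult_mat_vec[of _ ?n ?n]) auto
    also have "mat_adjoint W *\<^sub>v col W 0 = col (1\<^sub>m ?n) 0"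
      unfolding W(2)[symmetric] using W(1) by (intro col_mult2[symmetric, of _ ?n ?n _ ?n]) auto
    finally have "col A' 0 $ i = e * (if i = 0 then 1 else 0)" using that by simp
    then show ?thesis using that A' by auto
  qed
  obtain A1 A2 A0 A3 where split: "split_block A' 1 1 = (A1,A2,A0,A3)"
    by (cases "split_block A' 1 1", auto)
  have blocks: "A1 \<in> carrier_mat 1 1" "A2 \<in> carrier_mat 1 m" "A0 \<in> carrier_mat m 1"
    "A3 \<in> carrier_mat m m" "A' = four_block_mat A1 A2 A0 A3"
    using split_block[OF split, of m m] A' by auto
  have A0: "A0 = 0\<^sub>m m 1"
    using split[unfolded split_block_def Let_def] A'0 A' by (intro eq_matI) auto
  obtain T U where IH: "similar_mat_wit A3 T U (mat_adjoint U)" "upper_triangular T"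
    using Suc.IH[OF blocks(4)] by auto
  have one: "similar_mat_wit A1 A1 (1\<^sub>m 1) (mat_adjoint (1\<^sub>m 1))"
    using similar_mat_wit_refl[OF blocks(1)] by simp
  define V where "V = four_block_mat (1\<^sub>m 1) (0\<^sub>m 1 m) (0\<^sub>m m 1) U"
  define T' where "T' = four_block_mat A1 (mat_adjoint (1\<^sub>m 1) * A2 * U) (0\<^sub>m m 1) T"
  have "similar_mat_wit A' T' V (mat_adjoint V)"
    using similar_mat_wit_adjoint_four_block[OF one blocks(1) IH(1) blocks(4,2)]
    unfolding V_def T'_def blocks(5) A0 .
  from similar_mat_wit_trans[OF AA' this]
  have "similar_mat_wit A T' (W * V) (mat_adjoint (W * V))"
    using W(1) similar_mat_witD2(6)[OF blocks(4) IH(1)]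
    by (subst mat_adjoint_mult[of _ ?n ?n _ ?n]) (auto simp: V_def)
  moreover have "upper_triangular T'"
    unfolding T'_def using similar_mat_witD2(5)[OF blocks(4) IH(1)] blocks(1) IH(2)
    by (intro upper_triangular_four_block[of _ 1 _ m]) auto
  ultimately show ?case by blast
qed

section \<open>Triangular form inside blocks of bounded size\<close>

text \<open>Here \<open>b i\<close> is the index at which the block containing \<open>i\<close> starts.\<close>

definition block_triangular :: "nat \<Rightarrow> (nat \<Rightarrow> nat) \<Rightarrow> complex mat \<Rightarrow> bool" where
  "block_triangular r b T \<longleftrightarrow>
     (\<forall>i < dim_row T. b i \<le> i \<and> i < b i + r) \<and>
     (\<forall>i < dim_row T. \<forall>j < dim_col T. T $$ (i, j) \<noteq> 0 \<longrightarrow> i \<le> j \<and> b i = b j)"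

lemma block_triangularD:
  assumes "block_triangular r b T" "i < dim_row T"
  shows "b i \<le> i" "i < b i + r"
    and "\<lbrakk>j < dim_col T; T $$ (i, j) \<noteq> 0\<rbrakk> \<Longrightarrow> i \<le> j"
    and "\<lbrakk>j < dim_col T; T $$ (i, j) \<noteq> 0\<rbrakk> \<Longrightarrow> b i = b j"
  using assms unfolding block_triangular_def by blast+

lemma block_triangular_diag_blocks:
  assumes S: "S \<in> carrier_mat n n" "upper_triangular S" and n: "n \<le> r"
    and T: "T \<in> carrier_mat m m" "block_triangular r b T"
  shows "block_triangular r (\<lambda>i. if i < n then 0 else b (i - n) + n)
    (four_block_mat S (0\<^sub>m n m) (0\<^sub>m m n) T)"
proof -
  define X where "X = four_block_mat S (0\<^sub>m n m) (0\<^sub>m m n) T"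
  define c where "c i = (if i < n then 0 else b (i - n) + n)" for i
  have dims: "dim_row S = n" "dim_col S = n" "dim_row T = m" "dim_col T = m"
    "dim_row X = n + m" "dim_col X = n + m"
    using S T by (simp_all add: X_def)
  have X: "X $$ (i, j) = (if i < n then if j < n then S $$ (i, j) else 0
      else if j < n then 0 else T $$ (i - n, j - n))" if "i < n + m" "j < n + m" for i j
    using that dims by (simp add: X_def)
  have "c i \<le> i \<and> i < c i + r" if "i < n + m" for i
  proof (cases "i < n")
    case True
    then show ?thesis using n by (simp add: c_def)
  next
    case False
    then have "i - n < dim_row T" using that dims by simp
    from block_triangularD(1,2)[OF T(2) this]
    have "b (i - n) + n \<le> i" "i < b (i - n) + n + r" using False by linarith+
    then show ?thesis using False by (simp add: c_def)
  qed
  moreover have "i \<le> j \<and> c i = c j"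
    if ij: "i < n + m" "j < n + m" and nz: "X $$ (i, j) \<noteq> 0" for i j
  proof (cases "i < n")
    case True
    with nz have *: "j < n" "S $$ (i, j) \<noteq> 0" unfolding X[OF ij] by (simp_all split: if_splits)
    then have "\<not> j < i" using upper_triangularD[OF S(2)] True dims(1) by blast
    then show ?thesis using True *(1) by (simp add: c_def)
  next
    case False
    with nz have *: "\<not> j < n" "T $$ (i - n, j - n) \<noteq> 0"
      unfolding X[OF ij] by (simp_all split: if_splits)
    have "i - n < dim_row T" "j - n < dim_col T" using False *(1) ij dims by simp_all
    from block_triangularD(3,4)[OF T(2) this *(2)]
    show ?thesis using False *(1) by (simp add: c_def)
  qed
  ultimately have "block_triangular r c X"
    unfolding block_triangular_def dims by blast
  then show ?thesis unfolding X_def c_def .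
qed

text \<open>Each block gets its own triangularizing unitary. Their direct sum leaves the zero
  coupling blocks zero, so triangular form is gained without losing the bound on the block
  size.\<close>

lemma diag_block_mat_triangularization:
  assumes "\<forall>B \<in> set Bs. square_mat B \<and> dim_row B \<le> r"
  shows "\<exists>T U b. similar_mat_wit (diag_block_mat Bs) T U (mat_adjoint U) \<and> block_triangular r b T"
  using assms
proof (induction Bs)
  case Nil
  show ?case
  proof (intro exI conjI)
    show "similar_mat_wit (diag_block_mat []) (0\<^sub>m 0 0) (1\<^sub>m 0) (mat_adjoint (1\<^sub>m 0 :: complex mat))"
      unfolding diag_block_mat.simps mat_adjoint_one by (rule similar_mat_wit_refl) simp
    show "block_triangular r id (0\<^sub>m 0 0)" unfolding block_triangular_def by simp
  qed
next
  case (Cons B Bs)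
  let ?D = "diag_block_mat Bs"
  define n where "n = dim_row B"
  define m where "m = dim_row ?D"
  have "square_mat ?D" using Cons.prems by (intro diag_block_mat_square) auto
  then have D: "?D \<in> carrier_mat m m"
    unfolding m_def square_mat.simps by (rule carrier_matI[OF refl])
  have "square_mat B" and n: "n \<le> r" using Cons.prems unfolding n_def list.set by blast+
  then have B: "B \<in> carrier_mat n n"
    unfolding n_def square_mat.simps by (intro carrier_matI[OF refl])
  have "\<forall>B \<in> set Bs. square_mat B \<and> dim_row B \<le> r" using Cons.prems by simp
  from Cons.IH[OF this] obtain T U b
    where D': "similar_mat_wit ?D T U (mat_adjoint U)" "block_triangular r b T"
    by (elim exE conjE) (rule that)
  obtain S V where B': "similar_mat_wit B S V (mat_adjoint V)" "upper_triangular S"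
    using unitary_triangularization[OF B] by (elim exE conjE) (rule that)
  have T: "T \<in> carrier_mat m m" and U: "U \<in> carrier_mat m m"
    using similar_mat_witD2(5,6)[OF D D'(1)] .
  have S: "S \<in> carrier_mat n n" and V: "V \<in> carrier_mat n n"
    using similar_mat_witD2(5,6)[OF B B'(1)] .
  have zero: "mat_adjoint V * 0\<^sub>m n m * U = 0\<^sub>m n m"
    unfolding right_mult_zero_mat[OF mat_adjoint_carrier[OF V]] by (rule left_mult_zero_mat[OF U])
  have eq: "diag_block_mat (B # Bs) = four_block_mat B (0\<^sub>m n m) (0\<^sub>m m n) ?D"
    unfolding diag_block_mat.simps Let_def carrier_matD[OF D] carrier_matD[OF B] ..
  show ?case
    unfolding eq
    using similar_mat_wit_adjoint_four_block[OF B'(1) B D'(1) D zero_carrier_mat[of n m], unfolded zero]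
      block_triangular_diag_blocks[OF S B'(2) n T D'(2)]
    by (intro exI conjI)
qed

lemma r_normal_triangularization:
  assumes "r_normal r A"
  obtains T U b where "similar_mat_wit A T U (mat_adjoint U)" "block_triangular r b T"
proof -
  obtain Bs U where Bs: "\<forall>B \<in> set Bs. square_mat B \<and> dim_row B \<le> r"
    and U: "similar_mat_wit A (diag_block_mat Bs) U (mat_adjoint U)"
    using assms unfolding r_normal_def unitarily_similar_def by (elim exE conjE) (rule that)
  obtain T V b where V: "similar_mat_wit (diag_block_mat Bs) T V (mat_adjoint V)"
    and T: "block_triangular r b T"
    using diag_block_mat_triangularization[OF Bs] by (elim exE conjE) (rule that)
  note u = similar_mat_witD[OF refl U]
  note v = similar_mat_witD2[OF u(5) V]
  have "similar_mat_wit A T (U * V) (mat_adjoint (U * V))"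
    using similar_mat_wit_trans[OF U V] mat_adjoint_mult[OF u(6) v(6)] by (simp only:)
  then show ?thesis using T by (rule that)
qed

section \<open>Norm bounds\<close>

text \<open>Cauchy-Schwarz applied to the splitting of \<open>a x y * v y\<close> in modulus as
  \<open>sqrt (cmod (a x y))\<close> times \<open>sqrt (cmod (a x y)) * cmod (v y)\<close>. The row
  sums bound the first factor; after exchanging the sums the column sums bound the second.\<close>

lemma schur_test:
  fixes a :: "'a \<Rightarrow> 'b \<Rightarrow> complex" and v :: "'b \<Rightarrow> complex"
  assumes fin: "finite X" "finite Y" and K: "0 \<le> K"
    and rows: "\<And>x. x \<in> X \<Longrightarrow> (\<Sum>y\<in>Y. cmod (a x y)) \<le> K"
    and cols: "\<And>y. y \<in> Y \<Longrightarrow> (\<Sum>x\<in>X. cmod (a x y)) \<le> K"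
  shows "(\<Sum>x\<in>X. (cmod (\<Sum>y\<in>Y. a x y * v y))\<^sup>2) \<le> K\<^sup>2 * (\<Sum>y\<in>Y. (cmod (v y))\<^sup>2)"
proof -
  have "(cmod (\<Sum>y\<in>Y. a x y * v y))\<^sup>2 \<le> K * (\<Sum>y\<in>Y. cmod (a x y) * (cmod (v y))\<^sup>2)"
    if x: "x \<in> X" for x
  proof -
    let ?f = "\<lambda>y. sqrt (cmod (a x y))" and ?g = "\<lambda>y. sqrt (cmod (a x y)) * cmod (v y)"
    have "cmod (\<Sum>y\<in>Y. a x y * v y) \<le> (\<Sum>y\<in>Y. \<bar>?f y\<bar> * \<bar>?g y\<bar>)"
      by (rule order_trans[OF norm_sum]) (simp add: norm_mult mult.assoc[symmetric])
    also have "\<dots> \<le> L2_set ?f Y * L2_set ?g Y" by (rule L2_set_mult_ineq)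
    finally have "(cmod (\<Sum>y\<in>Y. a x y * v y))\<^sup>2 \<le> (L2_set ?f Y * L2_set ?g Y)\<^sup>2"
      by (rule power_mono) simp
    also have "\<dots> = (\<Sum>y\<in>Y. cmod (a x y)) * (\<Sum>y\<in>Y. cmod (a x y) * (cmod (v y))\<^sup>2)"
      by (simp add: L2_set_def power_mult_distrib sum_nonneg)
    also have "\<dots> \<le> K * (\<Sum>y\<in>Y. cmod (a x y) * (cmod (v y))\<^sup>2)"
      by (intro mult_right_mono rows x sum_nonneg) simp
    finally show ?thesis .
  qed
  then have "(\<Sum>x\<in>X. (cmod (\<Sum>y\<in>Y. a x y * v y))\<^sup>2)
    \<le> (\<Sum>x\<in>X. K * (\<Sum>y\<in>Y. cmod (a x y) * (cmod (v y))\<^sup>2))"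
    by (rule sum_mono)
  also have "\<dots> = K * (\<Sum>y\<in>Y. (\<Sum>x\<in>X. cmod (a x y)) * (cmod (v y))\<^sup>2)"
    unfolding sum_distrib_left[symmetric] sum_distrib_right by (subst sum.swap) simp
  also have "\<dots> \<le> K * (\<Sum>y\<in>Y. K * (cmod (v y))\<^sup>2)"
    by (intro mult_left_mono sum_mono mult_right_mono cols K) simp_all
  also have "\<dots> = K\<^sup>2 * (\<Sum>y\<in>Y. (cmod (v y))\<^sup>2)"
    by (simp add: sum_distrib_left power2_eq_square mult.assoc)
  finally show ?thesis .
qed

section \<open>Euclidean norms under unitary conjugation\<close>

definition sq_norm2 :: "complex vec \<Rightarrow> real" where
  "sq_norm2 v = (\<Sum>i<dim_vec v. (cmod (v $ i))\<^sup>2)"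

text \<open>The hypothesis of \<open>schur_test\<close> for matrices, a computable bound for the
  Euclidean operator norm. Asking for rows and columns alike makes it stable under adjoints.\<close>

definition abs_sums_le :: "real \<Rightarrow> complex mat \<Rightarrow> bool" where
  "abs_sums_le K A \<longleftrightarrow>
     (\<forall>i < dim_row A. (\<Sum>j<dim_col A. cmod (A $$ (i, j))) \<le> K) \<and>
     (\<forall>j < dim_col A. (\<Sum>i<dim_row A. cmod (A $$ (i, j))) \<le> K)"

lemma abs_sums_le_adjoint: "abs_sums_le K A \<Longrightarrow> abs_sums_le K (mat_adjoint A)"
  by (simp add: abs_sums_le_def)

lemma mult_mat_vec_index_sum:
  assumes "A \<in> carrier_mat n m" "v \<in> carrier_vec m" "i < n"
  shows "(A *\<^sub>v v) $ i = (\<Sum>j<m. A $$ (i, j) * v $ j)"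
  using assms by (simp add: scalar_prod_def lessThan_atLeast0)

lemma sq_norm2_mult_le:
  assumes A: "A \<in> carrier_mat n m" and v: "v \<in> carrier_vec m" and K: "abs_sums_le K A" "0 \<le> K"
  shows "sq_norm2 (A *\<^sub>v v) \<le> K\<^sup>2 * sq_norm2 v"
proof -
  have "sq_norm2 (A *\<^sub>v v) = (\<Sum>i<n. (cmod (\<Sum>j<m. A $$ (i, j) * v $ j))\<^sup>2)"
    unfolding sq_norm2_def using A mult_mat_vec_index_sum[OF A v] by simp
  also have "\<dots> \<le> K\<^sup>2 * (\<Sum>j<m. (cmod (v $ j))\<^sup>2)"
    using K A by (intro schur_test) (auto simp: abs_sums_le_def)
  finally show ?thesis using v by (simp add: sq_norm2_def)
qed

text \<open>Expanding the squared norm as a triple sum and summing over the row index first leaves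
  the Gram matrix of the columns, which is the identity.\<close>

lemma sq_norm2_isometry:
  assumes U: "U \<in> carrier_mat n n" and UU: "mat_adjoint U * U = 1\<^sub>m n" and v: "v \<in> carrier_vec n"
  shows "sq_norm2 (U *\<^sub>v v) = sq_norm2 v"
proof -
  have gram: "(\<Sum>i<n. cnj (U $$ (i, j)) * U $$ (i, l)) = (if j = l then 1 else 0)"
    if "j < n" "l < n" for j l
  proof -
    have "(mat_adjoint U * U) $$ (j, l) = (\<Sum>i<n. cnj (U $$ (i, j)) * U $$ (i, l))"
      using that U by (simp add: scalar_prod_def lessThan_atLeast0)
    then show ?thesis using that unfolding UU by simp
  qed
  have "complex_of_real (sq_norm2 (U *\<^sub>v v))
    = (\<Sum>i<n. (\<Sum>l<n. U $$ (i, l) * v $ l) * cnj (\<Sum>j<n. U $$ (i, j) * v $ j))"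
    unfolding sq_norm2_def of_real_sum using U mult_mat_vec_index_sum[OF U v]
    by (simp add: complex_norm_square del: of_real_power)
  also have "\<dots> = (\<Sum>i<n. \<Sum>l<n. \<Sum>j<n. v $ l * cnj (v $ j) * (cnj (U $$ (i, j)) * U $$ (i, l)))"
    unfolding cnj_sum sum_product by (simp add: algebra_simps)
  also have "\<dots> = (\<Sum>l<n. \<Sum>i<n. \<Sum>j<n. v $ l * cnj (v $ j) * (cnj (U $$ (i, j)) * U $$ (i, l)))"
    by (rule sum.swap)
  also have "\<dots> = (\<Sum>l<n. \<Sum>j<n. \<Sum>i<n. v $ l * cnj (v $ j) * (cnj (U $$ (i, j)) * U $$ (i, l)))"
    by (intro sum.cong[OF refl] sum.swap)
  also have "\<dots> = (\<Sum>l<n. \<Sum>j<n. v $ l * cnj (v $ j) * (if j = l then 1 else 0))"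
    unfolding sum_distrib_left[symmetric] by (intro sum.cong refl) (simp add: gram)
  also have "\<dots> = (\<Sum>l<n. v $ l * cnj (v $ l))"
    by (simp add: if_distrib[of "(*) _"] cong: if_cong)
  also have "\<dots> = complex_of_real (sq_norm2 v)"
    using v unfolding sq_norm2_def of_real_sum by (simp add: complex_norm_square del: of_real_power)
  finally show ?thesis by (simp only: of_real_eq_iff)
qed

lemma similar_mat_wit_adjoint:
  fixes A B U :: "complex mat"
  assumes "similar_mat_wit A B U (mat_adjoint U)"
  shows "similar_mat_wit (mat_adjoint A) (mat_adjoint B) U (mat_adjoint U)"
proof -
  define n where "n = dim_row A"
  note * = similar_mat_witD[OF n_def assms]
  have "mat_adjoint A = mat_adjoint (mat_adjoint U) * mat_adjoint (U * B)"
    unfolding *(3) by (rule mat_adjoint_mult[of _ n n _ n]) (use * in auto)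
  also have "mat_adjoint (U * B) = mat_adjoint B * mat_adjoint U"
    by (rule mat_adjoint_mult[of _ n n _ n]) (use * in auto)
  also have "mat_adjoint (mat_adjoint U) * (mat_adjoint B * mat_adjoint U) = U * mat_adjoint B * mat_adjoint U"
    unfolding mat_adjoint_adjoint
    by (rule assoc_mult_mat[symmetric, of _ n n _ n _ n]) (use * in auto)
  finally show ?thesis by (intro similar_mat_witI[of _ _ n]) (use * in auto)
qed

text \<open>Column \<open>j\<close> is the image of a unit vector under \<open>U\<close>,
  \<open>B\<close> and the adjoint of \<open>U\<close>; the outer two are isometries and
  \<open>B\<close> has norm at most \<open>K\<close>. Serves twice: to bound the columns of
  \<open>T\<close> through \<open>A\<close>, and those of the conjugated error matrix.\<close>

lemma unitary_conj_column_bound: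
  assumes A: "A \<in> carrier_mat n n" and sim: "similar_mat_wit A B U (mat_adjoint U)"
    and K: "abs_sums_le K B" "0 \<le> K" and j: "j < n"
  shows "(\<Sum>i<n. (cmod (A $$ (i, j)))\<^sup>2) \<le> K\<^sup>2"
proof -
  note * = similar_mat_witD2[OF A sim]
  define w where "w = mat_adjoint U *\<^sub>v unit_vec n j"
  have w: "w \<in> carrier_vec n" unfolding w_def using *(7) by simp
  have "col A j = A *\<^sub>v unit_vec n j"
    using A j by (intro eq_vecI) auto
  also have "\<dots> = U *\<^sub>v (B *\<^sub>v w)"
  proof -
    have "A *\<^sub>v unit_vec n j = (U * B) *\<^sub>v w"
      unfolding w_def by (subst *(3), rule assoc_mult_mat_vec[of _ n n _ n]) (use *(5-7) in auto)
    also have "\<dots> = U *\<^sub>v (B *\<^sub>v w)"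
      by (rule assoc_mult_mat_vec[of _ n n _ n]) (use *(5-6) w in auto)
    finally show ?thesis .
  qed
  finally have "sq_norm2 (col A j) = sq_norm2 (U *\<^sub>v (B *\<^sub>v w))" by simp
  also have "\<dots> = sq_norm2 (B *\<^sub>v w)"
    using *(2,5,6) w by (intro sq_norm2_isometry[of _ n]) auto
  also have "\<dots> \<le> K\<^sup>2 * sq_norm2 w" by (rule sq_norm2_mult_le[OF *(5) w K])
  also have "sq_norm2 w = sq_norm2 (unit_vec n j)"
    unfolding w_def using *(1,7) by (intro sq_norm2_isometry[of _ n]) auto
  also have "\<dots> = 1" using j by (simp add: sq_norm2_def if_distrib[of cmod] if_distrib[of "\<lambda>x. x\<^sup>2"] cong: if_cong)
  finally show ?thesis using A j by (simp add: sq_norm2_def)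
qed

lemma unitary_conj_row_bound:
  assumes A: "A \<in> carrier_mat n n" and sim: "similar_mat_wit A B U (mat_adjoint U)"
    and K: "abs_sums_le K B" "0 \<le> K" and i: "i < n"
  shows "(\<Sum>j<n. (cmod (A $$ (i, j)))\<^sup>2) \<le> K\<^sup>2"
  using unitary_conj_column_bound[OF mat_adjoint_carrier[OF A] similar_mat_wit_adjoint[OF sim]
      abs_sums_le_adjoint[OF K(1)] K(2) i] A i
  by simp

lemma unitary_column_norm:
  assumes U: "U \<in> carrier_mat n n" "mat_adjoint U * U = 1\<^sub>m n" and j: "j < n"
  shows "(\<Sum>i<n. (cmod (U $$ (i, j)))\<^sup>2) = 1"
proof -
  have "col U j = U *\<^sub>v unit_vec n j" using U j by (intro eq_vecI) auto
  then have "sq_norm2 (col U j) = sq_norm2 (unit_vec n j)"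
    using sq_norm2_isometry[OF U unit_vec_carrier] by simp
  then show ?thesis
    using U j by (simp add: sq_norm2_def if_distrib[of cmod] if_distrib[of "\<lambda>x. x\<^sup>2"] cong: if_cong)
qed

lemma conj_mat_index:
  fixes U B :: "complex mat"
  assumes "U \<in> carrier_mat n n" "B \<in> carrier_mat n n" "x < n" "y < n"
  shows "(U * B * mat_adjoint U) $$ (x, y) = (\<Sum>p<n. \<Sum>q<n. U $$ (x, p) * B $$ (p, q) * cnj (U $$ (y, q)))"
proof -
  have "(U * B * mat_adjoint U) $$ (x, y) = (\<Sum>q<n. (\<Sum>p<n. U $$ (x, p) * B $$ (p, q)) * cnj (U $$ (y, q)))"
    using assms by (simp add: scalar_prod_def lessThan_atLeast0)
  also have "\<dots> = (\<Sum>q<n. \<Sum>p<n. U $$ (x, p) * B $$ (p, q) * cnj (U $$ (y, q)))"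
    by (simp add: sum_distrib_right)
  also have "\<dots> = (\<Sum>p<n. \<Sum>q<n. U $$ (x, p) * B $$ (p, q) * cnj (U $$ (y, q)))"
    by (rule sum.swap)
  finally show ?thesis .
qed

section \<open>Powers of block-triangular matrices\<close>

text \<open>The first two terms of the binomial expansion. At \<open>d = 0\<close> the truncated
  exponent \<open>d - 1\<close> is harmless because its coefficient is \<open>0\<close>.\<close>

lemma power_add_ge_linear:
  fixes x c :: real
  assumes "0 \<le> x" "0 \<le> c"
  shows "x ^ d + real d * c * x ^ (d - 1) \<le> (x + c) ^ d"
proof (induction d)
  case (Suc d)
  have "x ^ Suc d + real (Suc d) * c * x ^ d \<le> (x + c) * (x ^ d + real d * c * x ^ (d - 1))"
  proof -
    have "x * (real d * c * x ^ (d - 1)) = real d * c * x ^ d" by (cases d) auto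
    moreover have "0 \<le> c * (real d * c * x ^ (d - 1))" using assms by simp
    moreover have "(x + c) * (x ^ d + real d * c * x ^ (d - 1))
      = x * x ^ d + c * x ^ d + x * (real d * c * x ^ (d - 1)) + c * (real d * c * x ^ (d - 1))"
      by (simp only: distrib_left distrib_right add.assoc)
    moreover have "x ^ Suc d + real (Suc d) * c * x ^ d = x * x ^ d + c * x ^ d + real d * c * x ^ d"
      by (simp add: algebra_simps)
    ultimately show ?thesis by linarith
  qed
  also have "\<dots> \<le> (x + c) * (x + c) ^ d"
    using Suc.IH assms by (intro mult_left_mono) auto
  finally show ?case by simp
qed simp

lemma pow_mat_Suc_index:
  assumes "T \<in> carrier_mat n n" "i < n" "j < n"
  shows "(T ^\<^sub>m Suc m) $$ (i, j) = (\<Sum>p<n. (T ^\<^sub>m m) $$ (i, p) * T $$ (p, j))"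
  using assms by (simp add: scalar_prod_def lessThan_atLeast0)

lemma block_triangular_pow_nonzero:
  assumes T: "T \<in> carrier_mat n n" "block_triangular r b T"
  shows "\<lbrakk>i < n; j < n; (T ^\<^sub>m m) $$ (i, j) \<noteq> 0\<rbrakk> \<Longrightarrow> i \<le> j \<and> b i = b j"
proof (induction m arbitrary: j)
  case 0
  then show ?case using T by (simp split: if_splits)
next
  case (Suc m)
  have "\<exists>p<n. (T ^\<^sub>m m) $$ (i, p) * T $$ (p, j) \<noteq> 0"
    using Suc.prems(3) sum.neutral unfolding pow_mat_Suc_index[OF T(1) Suc.prems(1,2)]
    by (metis (no_types, lifting) lessThan_iff)
  then obtain p where p: "p < n" "(T ^\<^sub>m m) $$ (i, p) \<noteq> 0" "T $$ (p, j) \<noteq> 0" by auto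
  then have "p \<le> j" "b p = b j"
    using block_triangularD(3,4)[OF T(2), of p j] T(1) Suc.prems(2) by auto
  with Suc.IH[OF Suc.prems(1) p(1,2)] show ?case by auto
qed

text \<open>The \<open>j\<close>-th unit vector is an eigenvector of \<open>T\<close>, hence of all
  powers of \<open>T\<close>.\<close>

lemma isolated_pow_index:
  fixes T :: "complex mat"
  assumes T: "T \<in> carrier_mat n n" and j: "j < n"
    and col: "\<And>p. \<lbrakk>p < n; p \<noteq> j\<rbrakk> \<Longrightarrow> T $$ (p, j) = 0"
  shows "i < n \<Longrightarrow> (T ^\<^sub>m m) $$ (i, j) = (if i = j then T $$ (j, j) ^ m else 0)"
proof (induction m)
  case 0
  then show ?case using T j by simp
next
  case (Suc m)
  have "(T ^\<^sub>m Suc m) $$ (i, j) = (\<Sum>p<n. (T ^\<^sub>m m) $$ (i, p) * T $$ (p, j))"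
    by (rule pow_mat_Suc_index[OF T Suc.prems j])
  also have "\<dots> = (\<Sum>p<n. if p = j then (T ^\<^sub>m m) $$ (i, j) * T $$ (j, j) else 0)"
    by (intro sum.cong) (auto simp: col)
  also have "\<dots> = (T ^\<^sub>m m) $$ (i, j) * T $$ (j, j)" using j by simp
  finally show ?case using Suc by simp
qed

text \<open>The last factor of the power is split off at an intermediate index \<open>p\<close>. The
  term \<open>p = j\<close> keeps the exponent \<open>j - i\<close> and costs a factor
  \<open>\<rho>\<close>; each of the \<open>j - i\<close> terms with \<open>p < j\<close> loses at
  least one exponent and costs at most \<open>c * \<rho>\<close>. By
  \<open>power_add_ge_linear\<close> this raises the base from \<open>c * (m + 1)\<close> to
  \<open>c * (m + 2)\<close>. Indices \<open>p\<close> with a large diagonal entry, where the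
  induction hypothesis fails to apply, contribute nothing by \<open>dichotomy\<close>.\<close>

lemma block_triangular_pow_bound:
  fixes T :: "complex mat" and \<rho> c k :: real
  assumes T: "T \<in> carrier_mat n n" "block_triangular r b T"
    and k: "0 \<le> k" "k \<le> c * \<rho>" and \<rho>: "0 < \<rho>" and c: "1 \<le> c"
    and entries: "\<And>i j. \<lbrakk>i < n; j < n\<rbrakk> \<Longrightarrow> cmod (T $$ (i, j)) \<le> k"
    and dichotomy: "\<And>p. p < n \<Longrightarrow>
      cmod (T $$ (p, p)) \<le> \<rho> \<or> (\<forall>j<n. j \<noteq> p \<longrightarrow> T $$ (p, j) = 0)"
  shows "\<lbrakk>i < n; j < n; cmod (T $$ (j, j)) \<le> \<rho>\<rbrakk> \<Longrightarrow>
    cmod ((T ^\<^sub>m m) $$ (i, j)) \<le> \<rho> ^ m * (c * (real m + 1)) ^ (j - i)"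
proof (induction m arbitrary: j)
  case 0
  then show ?case using T c by simp
next
  case (Suc m)
  note ij = Suc.prems(1,2)
  let ?x = "c * (real m + 1)"
  have x: "1 \<le> ?x" using mult_left_mono[of 1 "real m + 1" c] c by linarith
  show ?case
  proof (cases "i \<le> j")
    case False
    then have "(T ^\<^sub>m Suc m) $$ (i, j) = 0"
      using block_triangular_pow_nonzero[OF T ij] by blast
    then show ?thesis using \<rho> c by (simp del: pow_mat.simps)
  next
    case True
    define d where "d = j - i"
    define t where "t p = (T ^\<^sub>m m) $$ (i, p) * T $$ (p, j)" for p
    have t0: "t p = 0" if "p < n" "p \<notin> {i..j}" for p
    proof (rule ccontr)
      assume "t p \<noteq> 0"
      then have "(T ^\<^sub>m m) $$ (i, p) \<noteq> 0" "T $$ (p, j) \<noteq> 0" by (auto simp: t_def)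
      then show False
        using block_triangular_pow_nonzero[OF T ij(1) that(1)] that T(1)
          block_triangularD(3)[OF T(2), of p j] ij by auto
    qed
    have "(T ^\<^sub>m Suc m) $$ (i, j) = (\<Sum>p<n. t p)"
      unfolding t_def by (rule pow_mat_Suc_index[OF T(1) ij])
    also have "\<dots> = (\<Sum>p\<in>{i..j}. t p)"
      using ij t0 by (intro sum.mono_neutral_right) auto
    also have "\<dots> = (\<Sum>p\<in>{i..<j}. t p) + t j"
      using True by (simp add: sum.last_plus add.commute)
    finally have "cmod ((T ^\<^sub>m Suc m) $$ (i, j)) \<le> (\<Sum>p\<in>{i..<j}. cmod (t p)) + cmod (t j)"
      by (simp add: norm_triangle_le norm_sum)
    also have "(\<Sum>p\<in>{i..<j}. cmod (t p)) \<le> (\<Sum>p\<in>{i..<j}. (\<rho> ^ m * ?x ^ (d - 1)) * (c * \<rho>))"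
    proof (rule sum_mono)
      fix p assume p: "p \<in> {i..<j}"
      then have pn: "p < n" using ij by auto
      show "cmod (t p) \<le> (\<rho> ^ m * ?x ^ (d - 1)) * (c * \<rho>)"
      proof (cases "cmod (T $$ (p, p)) \<le> \<rho>")
        case True
        have "cmod ((T ^\<^sub>m m) $$ (i, p)) \<le> \<rho> ^ m * ?x ^ (p - i)"
          by (rule Suc.IH[OF ij(1) pn True])
        also have "\<dots> \<le> \<rho> ^ m * ?x ^ (d - 1)"
          using x p \<rho> by (intro mult_left_mono power_increasing) (auto simp: d_def)
        finally have *: "cmod ((T ^\<^sub>m m) $$ (i, p)) \<le> \<rho> ^ m * ?x ^ (d - 1)" .
        have "cmod (T $$ (p, j)) \<le> c * \<rho>" using entries[OF pn ij(2)] k by linarith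
        then show ?thesis
          unfolding t_def norm_mult using x \<rho> c by (intro mult_mono *) auto
      next
        case False
        then have "T $$ (p, j) = 0" using dichotomy[OF pn] p ij by auto
        then show ?thesis using x \<rho> c by (simp add: t_def)
      qed
    qed
    also have "cmod (t j) \<le> (\<rho> ^ m * ?x ^ d) * \<rho>"
      unfolding t_def norm_mult d_def using Suc.IH[OF ij Suc.prems(3)] Suc.prems(3) x \<rho> c
      by (intro mult_mono) auto
    also have "(\<Sum>p\<in>{i..<j}. (\<rho> ^ m * ?x ^ (d - 1)) * (c * \<rho>)) + (\<rho> ^ m * ?x ^ d) * \<rho>
      = \<rho> ^ Suc m * (?x ^ d + real d * c * ?x ^ (d - 1))"
      using True by (simp add: d_def algebra_simps)
    also have "\<dots> \<le> \<rho> ^ Suc m * (?x + c) ^ d"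
      using \<rho> c x by (intro mult_left_mono power_add_ge_linear) auto
    also have "?x + c = c * (real (Suc m) + 1)" by (simp add: algebra_simps)
    finally show ?thesis unfolding d_def by simp
  qed
qed

section \<open>The spectral counting argument\<close>

lemma block_triangular_upper_triangular: "\<lbrakk>T \<in> carrier_mat n n; block_triangular r b T\<rbrakk> \<Longrightarrow> upper_triangular T"
  by (rule upper_triangularI) (metis block_triangularD(3) carrier_matD linorder_not_less order.strict_trans)

text \<open>Similar matrices share the characteristic polynomial, and that of a triangular matrix
  splits into linear factors at the diagonal entries.\<close>

lemma eigenvalue_iff_diagonal:
  fixes A T :: "complex mat"
  assumes A: "A \<in> carrier_mat n n" and sim: "similar_mat_wit A T P Q" and T: "upper_triangular T"
  shows "eigenvalue A l \<longleftrightarrow> (\<exists>j<n. T $$ (j, j) = l)"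
proof -
  have Tn: "T \<in> carrier_mat n n" using similar_mat_witD2(5)[OF A sim] .
  have "char_poly A = char_poly T"
    using sim by (intro char_poly_similar) (auto simp: similar_mat_def)
  also have "\<dots> = (\<Prod>a\<leftarrow>diag_mat T. [:- a, 1:])" by (rule char_poly_upper_triangular[OF Tn T])
  finally have "char_poly A = (\<Prod>a\<leftarrow>diag_mat T. [:- a, 1:])" .
  moreover have "poly (\<Prod>a\<leftarrow>xs. [:- a, 1:]) l = 0 \<longleftrightarrow> l \<in> set xs" for xs
    by (induction xs) auto
  ultimately have "eigenvalue A l \<longleftrightarrow> l \<in> set (diag_mat T)"
    unfolding eigenvalue_root_char_poly[OF A] by simp
  then show ?thesis using Tn by (auto simp: diag_mat_def)
qed

text \<open>An entry of modulus \<open>K\<close> already exhausts the square sum. This is what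
  isolates the peripheral diagonal entries of \<open>T\<close>.\<close>

lemma unique_max_in_square_sum:
  fixes f :: "nat \<Rightarrow> complex"
  assumes "(\<Sum>i<n. (cmod (f i))\<^sup>2) \<le> K\<^sup>2" "j < n" "cmod (f j) = K" "p < n" "p \<noteq> j"
  shows "f p = 0"
proof -
  have "(\<Sum>i\<in>{j, p}. (cmod (f i))\<^sup>2) \<le> (\<Sum>i<n. (cmod (f i))\<^sup>2)"
    using assms by (intro sum_mono2) auto
  moreover have "(\<Sum>i\<in>{j, p}. (cmod (f i))\<^sup>2) = K\<^sup>2 + (cmod (f p))\<^sup>2" using assms by simp
  ultimately have "(cmod (f p))\<^sup>2 \<le> 0" using assms(1) by linarith
  then show ?thesis by simp
qed

text \<open>Everything about the graph that the counting needs, phrased for its adjacency matrix.\<close>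

locale triangularized_ramanujan =
  fixes A T U :: "complex mat" and n r M :: nat and b :: "nat \<Rightarrow> nat" and k :: real
  assumes A: "A \<in> carrier_mat n n"
    and sim: "similar_mat_wit A T U (mat_adjoint U)"
    and T_block: "block_triangular r b T"
    and sums: "abs_sums_le k A"
    and k: "1 < k" and M: "1 \<le> M"
    and eigenvalues: "\<And>l. eigenvalue A l \<Longrightarrow> cmod l \<le> sqrt k \<or> cmod l = k"
    and peripheral: "\<And>v l. \<lbrakk>eigenvector A v l; cmod l = k\<rbrakk> \<Longrightarrow> (l / of_real k) ^ M = 1"
    and perron: "eigenvalue A (of_real k)"
    and perron_const: "\<And>v x y. \<lbrakk>eigenvector A v (of_real k); x < n; y < n\<rbrakk> \<Longrightarrow> v $ x = v $ y"
begin

section \<open>The peripheral part of \<open>T\<close>\<close>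

lemma T: "T \<in> carrier_mat n n" and U: "U \<in> carrier_mat n n"
  and UU: "mat_adjoint U * U = 1\<^sub>m n" "U * mat_adjoint U = 1\<^sub>m n"
  using similar_mat_witD2[OF A sim] by auto

lemma k_pos: "0 < k" "0 \<le> k" "1 \<le> k" "sqrt k < k" "1 \<le> sqrt k"
  using k real_sqrt_less_mono[of k "k * k"] by auto

lemma sim_T: "similar_mat_wit T A (mat_adjoint U) (mat_adjoint (mat_adjoint U))"
  using similar_mat_wit_sym[OF sim] by simp

text \<open>\<open>sums\<close> bounds the operator norm of \<open>A\<close> by \<open>k\<close>,
  and \<open>T\<close> inherits the bound as a unitary conjugate of \<open>A\<close>.\<close>

lemma T_row: "i < n \<Longrightarrow> (\<Sum>j<n. (cmod (T $$ (i, j)))\<^sup>2) \<le> k\<^sup>2"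
  using unitary_conj_row_bound[OF T sim_T sums] k by simp

lemma T_col: "j < n \<Longrightarrow> (\<Sum>i<n. (cmod (T $$ (i, j)))\<^sup>2) \<le> k\<^sup>2"
  using unitary_conj_column_bound[OF T sim_T sums] k by simp

lemma T_entry:
  assumes "i < n" "j < n" shows "cmod (T $$ (i, j)) \<le> k"
proof -
  have "(cmod (T $$ (i, j)))\<^sup>2 \<le> (\<Sum>j<n. (cmod (T $$ (i, j)))\<^sup>2)"
    using assms by (intro member_le_sum) auto
  with T_row[OF assms(1)] have "(cmod (T $$ (i, j)))\<^sup>2 \<le> k\<^sup>2" by linarith
  then show ?thesis using k power2_le_imp_le by fastforce
qed

lemma isolated:
  assumes "j < n" "cmod (T $$ (j, j)) = k" "p < n" "p \<noteq> j"
  shows "T $$ (p, j) = 0" "T $$ (j, p) = 0"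
  by (rule unique_max_in_square_sum[OF T_col[OF assms(1)] assms],
      rule unique_max_in_square_sum[OF T_row[OF assms(1)] assms])

lemma diagonal_eigenvalue: "eigenvalue A l \<longleftrightarrow> (\<exists>j<n. T $$ (j, j) = l)"
  by (rule eigenvalue_iff_diagonal[OF A sim block_triangular_upper_triangular[OF T T_block]])

lemma diagonal: "j < n \<Longrightarrow> cmod (T $$ (j, j)) \<le> sqrt k \<or> cmod (T $$ (j, j)) = k"
  using eigenvalues diagonal_eigenvalue by blast

text \<open>Compare column \<open>j\<close> on both sides of \<open>A * U = U * T\<close>: by
  isolation, column \<open>j\<close> of \<open>T\<close> has only its diagonal entry.\<close>

lemma eigenvector_column:
  assumes j: "j < n" and m: "cmod (T $$ (j, j)) = k"
  shows "eigenvector A (col U j) (T $$ (j, j))"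
proof -
  have "A * U = U * T * (mat_adjoint U * U)"
    unfolding similar_mat_witD2(3)[OF A sim]
    by (rule assoc_mult_mat[of _ n n _ n _ n]) (use T U in auto)
  then have AU: "A * U = U * T" using UU T U by simp
  have "(A *\<^sub>v col U j) $ x = (T $$ (j, j) \<cdot>\<^sub>v col U j) $ x" if "x < n" for x
  proof -
    have "(A *\<^sub>v col U j) $ x = (A * U) $$ (x, j)" using that j A U by simp
    also have "\<dots> = (\<Sum>p<n. U $$ (x, p) * T $$ (p, j))"
      unfolding AU using that j T U by (simp add: scalar_prod_def lessThan_atLeast0)
    also have "\<dots> = (\<Sum>p<n. if p = j then U $$ (x, j) * T $$ (j, j) else 0)"
      using isolated(1)[OF j m] by (intro sum.cong) auto
    also have "\<dots> = (T $$ (j, j) \<cdot>\<^sub>v col U j) $ x" using j that U by simp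
    finally show ?thesis .
  qed
  then have "A *\<^sub>v col U j = T $$ (j, j) \<cdot>\<^sub>v col U j" using A U by (intro eq_vecI) auto
  moreover have "col U j \<noteq> 0\<^sub>v n"
  proof
    assume *: "col U j = 0\<^sub>v n"
    have "U $$ (i, j) = 0" if "i < n" for i
      using arg_cong[OF *, of "\<lambda>v. v $ i"] that j U by simp
    then show False using unitary_column_norm[OF U UU(1) j] by simp
  qed
  ultimately show ?thesis unfolding eigenvector_def using A U by (auto intro!: carrier_vecI)
qed

text \<open>The column is constant and of norm \<open>1\<close>, so its entries share one value of
  squared modulus \<open>1 / n\<close>; the phase cancels in the product.\<close>

lemma perron_column:
  assumes j: "j < n" "T $$ (j, j) = of_real k" and xy: "x < n" "y < n"
  shows "U $$ (x, j) * cnj (U $$ (y, j)) = of_real (1 / real n)"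
proof -
  have const: "U $$ (i, j) = U $$ (x, j)" if "i < n" for i
    using perron_const[OF eigenvector_column[of j, unfolded j(2)] that xy(1)] j k that xy U by simp
  have "1 = (\<Sum>i<n. (cmod (U $$ (i, j)))\<^sup>2)" using unitary_column_norm[OF U UU(1) j(1)] by simp
  also have "\<dots> = real n * (cmod (U $$ (x, j)))\<^sup>2" by (simp add: const)
  finally have "(cmod (U $$ (x, j)))\<^sup>2 = 1 / real n" using xy by (simp add: field_simps)
  then show ?thesis unfolding const[OF xy(2)] complex_norm_square[symmetric] of_real_power[symmetric] by simp
qed

text \<open>After division by \<open>k\<close> the diagonal entry is an \<open>M\<close>-th root of
  unity, and the geometric sum over a full period vanishes unless that root is
  \<open>1\<close>.\<close>

lemma peripheral_power_sum:
  assumes j: "j < n" "cmod (T $$ (j, j)) = k"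
  shows "(\<Sum>i<M. T $$ (j, j) ^ (l + i) / of_real k ^ i)
    = (if T $$ (j, j) = of_real k then of_real (real M * k ^ l) else 0)"
proof -
  let ?z = "T $$ (j, j) / of_real k"
  have "(\<Sum>i<M. T $$ (j, j) ^ (l + i) / of_real k ^ i) = T $$ (j, j) ^ l * (\<Sum>i<M. ?z ^ i)"
    by (simp add: power_add power_divide sum_distrib_left)
  moreover have "(\<Sum>i<M. ?z ^ i) = 0" if "T $$ (j, j) \<noteq> of_real k"
  proof -
    have "(1 - ?z) * (\<Sum>i<M. ?z ^ i) = 1 - ?z ^ M" by (rule one_diff_power_eq[symmetric])
    also have "\<dots> = 0" using peripheral[OF eigenvector_column[OF j] j(2)] by simp
    finally show ?thesis using that k by (auto simp: field_simps)
  qed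
  ultimately show ?thesis using k by (auto simp: mult.commute)
qed

text \<open>An entry of a sum of \<open>M\<close> consecutive powers of \<open>T\<close>, where the
  weights bring the peripheral contributions to the common size \<open>k ^ l\<close> so that they
  can cancel.\<close>

definition power_sum :: "nat \<Rightarrow> nat \<Rightarrow> nat \<Rightarrow> complex" where
  "power_sum l p q = (\<Sum>i<M. (T ^\<^sub>m (l + i)) $$ (p, q) / of_real k ^ i)"

text \<open>\<open>M\<close> summands, each bounded through
  \<open>block_triangular_pow_bound\<close> with \<open>\<rho> = c = sqrt k\<close> and exponent at
  most \<open>r - 1\<close>.\<close>

definition error_bound :: "nat \<Rightarrow> real" where
  "error_bound l = real M * (sqrt k ^ l * (sqrt k * (real l + real M)) ^ (r - 1))"

definition error_mat :: "nat \<Rightarrow> complex mat" where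
  "error_mat l = mat n n (\<lambda>(p, q). if cmod (T $$ (q, q)) \<le> sqrt k then power_sum l p q else 0)"

lemma error_bound_nonneg: "0 \<le> error_bound l"
  unfolding error_bound_def using k by simp

text \<open>In a column with peripheral diagonal entry the powers of \<open>T\<close> have no
  off-diagonal entries, so \<open>peripheral_power_sum\<close> evaluates the sum exactly and only
  the eigenvalue \<open>k\<close> survives. All other columns form the error.\<close>

lemma power_sum_decomp:
  assumes pq: "p < n" "q < n"
  shows "power_sum l p q = error_mat l $$ (p, q)
    + (if p = q \<and> T $$ (q, q) = of_real k then of_real (real M * k ^ l) else 0)"
proof (cases "cmod (T $$ (q, q)) \<le> sqrt k")
  case True
  then have "T $$ (q, q) \<noteq> of_real k" using k_pos by auto
  then show ?thesis using True pq by (simp add: error_mat_def)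
next
  case False
  then have m: "cmod (T $$ (q, q)) = k" using diagonal[OF pq(2)] by auto
  have "(T ^\<^sub>m i) $$ (p, q) = (if p = q then T $$ (q, q) ^ i else 0)" for i
    using isolated_pow_index[OF T pq(2) isolated(1)[OF pq(2) m] pq(1)] by simp
  then have "power_sum l p q = (if p = q then \<Sum>i<M. T $$ (q, q) ^ (l + i) / of_real k ^ i else 0)"
    unfolding power_sum_def by simp
  then show ?thesis
    unfolding peripheral_power_sum[OF pq(2) m] using False pq by (auto simp: error_mat_def)
qed

lemma error_mat_nonzero:
  assumes pq: "p < n" "q < n" and nz: "error_mat l $$ (p, q) \<noteq> 0"
  shows "p \<le> q" "b p = b q"
proof -
  have "power_sum l p q \<noteq> 0" using nz pq by (auto simp: error_mat_def split: if_splits)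
  then obtain i where "(T ^\<^sub>m (l + i)) $$ (p, q) \<noteq> 0"
    unfolding power_sum_def by (metis (no_types, lifting) div_0 sum.neutral)
  from block_triangular_pow_nonzero[OF T T_block pq this] show "p \<le> q" "b p = b q" by auto
qed

lemma error_mat_le:
  assumes pq: "p < n" "q < n"
  shows "cmod (error_mat l $$ (p, q)) \<le> error_bound l"
proof (cases "error_mat l $$ (p, q) = 0")
  case True
  then show ?thesis using error_bound_nonneg by simp
next
  case False
  then have good: "cmod (T $$ (q, q)) \<le> sqrt k" and E: "error_mat l $$ (p, q) = power_sum l p q"
    using pq by (auto simp: error_mat_def split: if_splits)
  have "b p \<le> p" "q < b q + r"
    using block_triangularD(1,2)[OF T_block] T pq by auto
  \<comment> \<open>Both indices lie in the same block, whose size is at most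
    \<open>r\<close>.\<close>
  then have d: "q - p \<le> r - 1" using error_mat_nonzero[OF pq False] by auto
  have "cmod ((T ^\<^sub>m (l + i)) $$ (p, q) / of_real k ^ i)
      \<le> sqrt k ^ l * (sqrt k * (real l + real M)) ^ (r - 1)" if i: "i < M" for i
  proof -
    have "cmod ((T ^\<^sub>m (l + i)) $$ (p, q)) \<le> sqrt k ^ (l + i) * (sqrt k * (real (l + i) + 1)) ^ (q - p)"
    proof (rule block_triangular_pow_bound[OF T T_block k_pos(2) _ _ k_pos(5) T_entry _ pq good])
      show "k \<le> sqrt k * sqrt k" using k_pos by simp
      show "0 < sqrt k" using k_pos by simp
      fix p assume "p < n"
      then show "cmod (T $$ (p, p)) \<le> sqrt k \<or> (\<forall>j<n. j \<noteq> p \<longrightarrow> T $$ (p, j) = 0)"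
        using diagonal isolated(2) by blast
    qed
    also have "(sqrt k * (real (l + i) + 1)) ^ (q - p) \<le> (sqrt k * (real l + real M)) ^ (q - p)"
      using i k_pos by (intro power_mono mult_left_mono) auto
    also have "\<dots> \<le> (sqrt k * (real l + real M)) ^ (r - 1)"
      using d M mult_mono[OF k_pos(5), of 1 "real l + real M"] k_pos(2)
      by (intro power_increasing) simp_all
    \<comment> \<open>The crude bound \<open>sqrt k ^ i \<le> k ^ i\<close> suffices, since the
      weight divides by \<open>k ^ i\<close>.\<close>
    also have "sqrt k ^ (l + i) * \<dots> \<le> sqrt k ^ l * k ^ i * (sqrt k * (real l + real M)) ^ (r - 1)"
      unfolding power_add using k_pos
      by (intro mult_right_mono mult_left_mono power_mono) auto
    finally have "cmod ((T ^\<^sub>m (l + i)) $$ (p, q))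
      \<le> k ^ i * (sqrt k ^ l * (sqrt k * (real l + real M)) ^ (r - 1))"
      using k_pos by (simp add: ac_simps mult_left_mono)
    then show ?thesis using k_pos by (simp add: norm_divide norm_power field_simps)
  qed
  then have "(\<Sum>i<M. cmod ((T ^\<^sub>m (l + i)) $$ (p, q) / of_real k ^ i)) \<le> error_bound l"
    unfolding error_bound_def by (intro order_trans[OF sum_bounded_above]) auto
  then show ?thesis
    unfolding E power_sum_def by (rule order_trans[OF norm_sum])
qed

text \<open>A row or column of the error matrix is supported on one block, hence on at most
  \<open>r\<close> entries.\<close>

lemma error_mat_sums: "abs_sums_le (real r * error_bound l) (error_mat l)"
proof -
  have block: "p \<in> {b q..<b q + r}" if "p < n" "b p = b q" for p q
    using block_triangularD(1,2)[OF T_block, of p] T that by auto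
  have bound: "(\<Sum>q<n. f q) \<le> real r * error_bound l"
    if "\<And>q. q < n \<Longrightarrow> f q \<le> error_bound l" "\<And>q. \<lbrakk>q < n; b q \<noteq> c\<rbrakk> \<Longrightarrow> f q = 0" for f c
  proof -
    have B: "card ({..<n} \<inter> {q. b q = c}) \<le> r"
    proof (cases "{..<n} \<inter> {q. b q = c} = {}")
      case False
      then obtain q where "b q = c" by auto
      then have "{..<n} \<inter> {q. b q = c} \<subseteq> {c..<c + r}" using block[of _ q] by auto
      from card_mono[OF _ this] show ?thesis by simp
    qed simp
    have "(\<Sum>q<n. f q) = (\<Sum>q\<in>{..<n} \<inter> {q. b q = c}. f q)"
      using that(2) by (intro sum.mono_neutral_right) auto
    also have "\<dots> \<le> real (card ({..<n} \<inter> {q. b q = c})) * error_bound l"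
      using that(1) by (intro sum_bounded_above) auto
    also have "\<dots> \<le> real r * error_bound l" using B error_bound_nonneg by (intro mult_right_mono) auto
    finally show ?thesis .
  qed
  have zero: "error_mat l $$ (p, q) = 0" if "p < n" "q < n" "b p \<noteq> b q" for p q
    using error_mat_nonzero(2)[OF that(1,2)] that(3) by blast
  have dims: "dim_row (error_mat l) = n" "dim_col (error_mat l) = n" by (simp_all add: error_mat_def)
  show ?thesis
    unfolding abs_sums_le_def dims
  proof (intro conjI allI impI)
    show "(\<Sum>j<n. cmod (error_mat l $$ (i, j))) \<le> real r * error_bound l" if "i < n" for i
    proof (rule bound)
      show "cmod (error_mat l $$ (i, q)) \<le> error_bound l" if "q < n" for q
        by (rule error_mat_le[OF \<open>i < n\<close> that])
      show "cmod (error_mat l $$ (i, q)) = 0" if "q < n" "b q \<noteq> b i" for q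
        using zero[OF \<open>i < n\<close> that(1) that(2)[symmetric]] by simp
    qed
    show "(\<Sum>i<n. cmod (error_mat l $$ (i, j))) \<le> real r * error_bound l" if "j < n" for j
    proof (rule bound)
      show "cmod (error_mat l $$ (q, j)) \<le> error_bound l" if "q < n" for q
        by (rule error_mat_le[OF that \<open>j < n\<close>])
      show "cmod (error_mat l $$ (q, j)) = 0" if "q < n" "b q \<noteq> b j" for q
        using zero[OF that(1) \<open>j < n\<close> that(2)] by simp
    qed
  qed
qed

section \<open>Counting pairs without a walk of length in a window of \<open>M\<close>
  values\<close>

definition walk_sum :: "nat \<Rightarrow> nat \<Rightarrow> nat \<Rightarrow> complex" where
  "walk_sum l x y = (\<Sum>i<M. (A ^\<^sub>m (l + i)) $$ (x, y) / of_real k ^ i)"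

text \<open>Conjugate \<open>power_sum_decomp\<close> by \<open>U\<close>. Each diagonal entry equal
  to \<open>k\<close> contributes \<open>M * k ^ l / n\<close> by \<open>perron_column\<close>, so
  the multiplicity appears as a cardinality.\<close>

lemma walk_sum_eq:
  assumes xy: "x < n" "y < n"
  shows "walk_sum l x y = (U * error_mat l * mat_adjoint U) $$ (x, y)
    + of_real (real (card {q. q < n \<and> T $$ (q, q) = of_real k}) * (real M * k ^ l / real n))"
proof -
  have "walk_sum l x y
    = (\<Sum>i<M. (\<Sum>p<n. \<Sum>q<n. U $$ (x, p) * (T ^\<^sub>m (l + i)) $$ (p, q) * cnj (U $$ (y, q))) / of_real k ^ i)"
    unfolding walk_sum_def similar_mat_wit_pow_id[OF sim]
    using conj_mat_index[OF U _ xy] T by simp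
  also have "\<dots> = (\<Sum>i<M. \<Sum>p<n. \<Sum>q<n.
      U $$ (x, p) * ((T ^\<^sub>m (l + i)) $$ (p, q) / of_real k ^ i) * cnj (U $$ (y, q)))"
    by (simp add: sum_divide_distrib)
  also have "\<dots> = (\<Sum>p<n. \<Sum>q<n. U $$ (x, p) * power_sum l p q * cnj (U $$ (y, q)))"
    unfolding power_sum_def sum_distrib_left sum_distrib_right
    by (rule trans[OF sum.swap], rule sum.cong[OF refl], rule sum.swap)
  also have "\<dots> = (\<Sum>p<n. \<Sum>q<n. U $$ (x, p) * error_mat l $$ (p, q) * cnj (U $$ (y, q))
     + (if q = p then if T $$ (q, q) = of_real k
          then U $$ (x, q) * cnj (U $$ (y, q)) * of_real (real M * k ^ l) else 0 else 0))"
    by (intro sum.cong refl) (auto simp: power_sum_decomp algebra_simps)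
  also have "\<dots> = (U * error_mat l * mat_adjoint U) $$ (x, y)
     + (\<Sum>p<n. if T $$ (p, p) = of_real k
          then U $$ (x, p) * cnj (U $$ (y, p)) * of_real (real M * k ^ l) else 0)"
    unfolding sum.distrib using conj_mat_index[OF U _ xy, of "error_mat l"]
    by (simp add: error_mat_def)
  also have "(\<Sum>p<n. if T $$ (p, p) = of_real k
          then U $$ (x, p) * cnj (U $$ (y, p)) * of_real (real M * k ^ l) else 0)
    = (\<Sum>p<n. if T $$ (p, p) = of_real k then of_real (real M * k ^ l / real n) else 0)"
    using perron_column[OF _ _ xy] by (intro sum.cong) (auto simp flip: of_real_mult)
  also have "\<dots> = (\<Sum>p\<in>{q. q < n \<and> T $$ (q, q) = of_real k}. of_real (real M * k ^ l / real n))"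
    unfolding sum.If_cases[OF finite_lessThan] by (simp add: Int_def)
  also have "\<dots> = of_real (real (card {q. q < n \<and> T $$ (q, q) = of_real k}) * (real M * k ^ l / real n))"
    by simp
  finally show ?thesis .
qed

text \<open>If the sum vanishes, the error has to cancel the main term, whose multiplicity is at
  least \<open>1\<close> by \<open>perron\<close>.\<close>

lemma walk_sum_zero_error:
  assumes xy: "x < n" "y < n" and zero: "walk_sum l x y = 0"
  shows "real M * k ^ l / real n \<le> cmod ((U * error_mat l * mat_adjoint U) $$ (x, y))"
proof -
  define J where "J = card {q. q < n \<and> T $$ (q, q) = of_real k}"
  have "{q. q < n \<and> T $$ (q, q) = of_real k} \<noteq> {}" using perron diagonal_eigenvalue by auto
  then have "1 \<le> J" unfolding J_def by (simp add: Suc_leI card_gt_0_iff)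
  then have "real M * k ^ l / real n \<le> real J * (real M * k ^ l / real n)"
    using k_pos mult_right_mono[of 1 "real J" "real M * k ^ l / real n"] by simp
  also have "(U * error_mat l * mat_adjoint U) $$ (x, y) = - of_real (real J * (real M * k ^ l / real n))"
    using walk_sum_eq[OF xy, of l] zero unfolding J_def by (simp add: eq_neg_iff_add_eq_0)
  then have "real J * (real M * k ^ l / real n) = cmod ((U * error_mat l * mat_adjoint U) $$ (x, y))"
    using k_pos by (simp del: of_real_mult of_real_divide)
  finally show ?thesis .
qed

text \<open>A Chebyshev count: every index in \<open>S\<close> takes at least
  \<open>(M * k ^ l / n)\<^sup>2\<close> from the square sum. The squared error bound contains
  \<open>k ^ l\<close> only once, so one factor \<open>k ^ l\<close> remains on the left.\<close>

lemma card_le_of_error: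
  assumes S: "S \<subseteq> {..<n}" and l: "\<And>y. y \<in> S \<Longrightarrow> real M * k ^ l / real n \<le> cmod (f y)"
    and f: "(\<Sum>y<n. (cmod (f y))\<^sup>2) \<le> (real r * error_bound l)\<^sup>2" and n: "0 < n"
  shows "real (card S) * k ^ l \<le> (real r)\<^sup>2 * k ^ (r - 1) * (real l + real M) ^ (2 * (r - 1)) * (real n)\<^sup>2"
proof -
  have "real (card S) * (real M * k ^ l / real n)\<^sup>2 \<le> (\<Sum>y\<in>S. (cmod (f y))\<^sup>2)"
    using l k_pos by (intro sum_bounded_below power_mono) auto
  also have "\<dots> \<le> (\<Sum>y<n. (cmod (f y))\<^sup>2)" using S by (intro sum_mono2) auto
  also note f
  also have "(real r * error_bound l)\<^sup>2
    = (real r)\<^sup>2 * (real M)\<^sup>2 * (sqrt k ^ 2) ^ l * ((sqrt k ^ 2) ^ (r - 1) * (real l + real M) ^ (2 * (r - 1)))"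
    unfolding error_bound_def power_mult_distrib power_mult[symmetric] by (simp add: mult.commute ac_simps)
  finally have "real (card S) * (real M * k ^ l / real n)\<^sup>2
    \<le> (real r)\<^sup>2 * (real M)\<^sup>2 * k ^ l * (k ^ (r - 1) * (real l + real M) ^ (2 * (r - 1)))"
    using k_pos by simp
  then have "(real M)\<^sup>2 * k ^ l * (real (card S) * k ^ l)
    \<le> (real M)\<^sup>2 * k ^ l * ((real r)\<^sup>2 * k ^ (r - 1) * (real l + real M) ^ (2 * (r - 1)) * (real n)\<^sup>2)"
    using n by (simp add: field_simps power2_eq_square)
  then show ?thesis using k_pos M by (subst (asm) mult_le_cancel_left_pos) auto
qed

lemma error_conj:
  "U * error_mat l * mat_adjoint U \<in> carrier_mat n n"
  "similar_mat_wit (U * error_mat l * mat_adjoint U) (error_mat l) U (mat_adjoint U)"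
  using U UU by (auto intro!: similar_mat_witI[of _ _ n] simp: error_mat_def)

theorem card_unreached_from:
  assumes x: "x < n"
  shows "real (card {y. y < n \<and> (\<forall>i<M. (A ^\<^sub>m (l + i)) $$ (x, y) = 0)}) * k ^ l
    \<le> (real r)\<^sup>2 * k ^ (r - 1) * (real l + real M) ^ (2 * (r - 1)) * (real n)\<^sup>2"
proof (rule card_le_of_error)
  show "(\<Sum>y<n. (cmod ((U * error_mat l * mat_adjoint U) $$ (x, y)))\<^sup>2) \<le> (real r * error_bound l)\<^sup>2"
    using error_bound_nonneg by (intro unitary_conj_row_bound[OF error_conj error_mat_sums _ x]) simp
qed (use x in \<open>auto intro!: walk_sum_zero_error simp: walk_sum_def\<close>)

theorem card_unreached_to:
  assumes y: "y < n"
  shows "real (card {x. x < n \<and> (\<forall>i<M. (A ^\<^sub>m (l + i)) $$ (x, y) = 0)}) * k ^ l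
    \<le> (real r)\<^sup>2 * k ^ (r - 1) * (real l + real M) ^ (2 * (r - 1)) * (real n)\<^sup>2"
proof (rule card_le_of_error)
  show "(\<Sum>x<n. (cmod ((U * error_mat l * mat_adjoint U) $$ (x, y)))\<^sup>2) \<le> (real r * error_bound l)\<^sup>2"
    using error_bound_nonneg by (intro unitary_conj_column_bound[OF error_conj error_mat_sums _ y]) simp
qed (use y in \<open>auto intro!: walk_sum_zero_error simp: walk_sum_def\<close>)

end

section \<open>Adjacency matrices and walks\<close>

lemma vertex_list:
  assumes "finite (verts G)"
  shows "distinct (vertex_list G)" "set (vertex_list G) = verts G" "length (vertex_list G) = card (verts G)"
proof -
  have "\<exists>vs. distinct vs \<and> set vs = verts G" using finite_distinct_list[OF assms] by auto
  from someI_ex[OF this] show *: "distinct (vertex_list G)" "set (vertex_list G) = verts G"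
    unfolding vertex_list_def by auto
  show "length (vertex_list G) = card (verts G)" using distinct_card[OF *(1)] *(2) by simp
qed

text \<open>The least positive exponent killing \<open>z\<close> divides every element of
  \<open>S\<close> by division with remainder, hence divides the gcd. If \<open>S\<close> has no
  positive element, the gcd is \<open>0\<close>.\<close>

lemma power_Gcd_eq_one:
  fixes z :: "'a :: comm_monoid_mult" and S :: "nat set"
  assumes "\<And>l. l \<in> S \<Longrightarrow> z ^ l = 1"
  shows "z ^ Gcd S = 1"
proof (cases "S \<subseteq> {0}")
  case True
  then have "Gcd S = 0" by (rule Gcd_0_iff[THEN iffD2])
  then show ?thesis by (simp only: power_0)
next
  case False
  then obtain a where a: "0 < a" "z ^ a = 1" using assms by auto
  define d where "d = (LEAST d. 0 < d \<and> z ^ d = 1)"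
  have d: "0 < d" "z ^ d = 1" and least: "\<And>e. \<lbrakk>0 < e; z ^ e = 1\<rbrakk> \<Longrightarrow> d \<le> e"
    using LeastI[of "\<lambda>d. 0 < d \<and> z ^ d = 1" a] Least_le[of "\<lambda>d. 0 < d \<and> z ^ d = 1"] a
    unfolding d_def by auto
  have "d dvd l" if "l \<in> S" for l
  proof -
    have "1 = z ^ (d * (l div d) + l mod d)" using assms[OF that] by simp
    also have "\<dots> = z ^ (l mod d)" unfolding power_add power_mult d(2) by simp
    finally have "z ^ (l mod d) = 1" by simp
    then have "\<not> 0 < l mod d" using least[of "l mod d"] d(1) mod_less_divisor[OF d(1), of l] by linarith
    then show ?thesis by auto
  qed
  then have "d dvd Gcd S" by (rule Gcd_greatest)
  then obtain c where "Gcd S = d * c" by auto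
  then show ?thesis using d(2) by (simp add: power_mult)
qed

context fin_digraph
begin

abbreviation num_verts :: nat where "num_verts \<equiv> card (verts G)"

abbreviation vertex :: "nat \<Rightarrow> 'a" where "vertex i \<equiv> vertex_list G ! i"

lemma vertex_bij: "bij_betw vertex {..<num_verts} (verts G)"
  using bij_betw_nth[of "vertex_list G"] vertex_list[OF finite_verts] by auto

lemma vertex_in_verts: "i < num_verts \<Longrightarrow> vertex i \<in> verts G"
  using vertex_bij by (auto simp: bij_betw_def)

lemma adjacency_carrier: "adjacency_matrix G \<in> carrier_mat num_verts num_verts"
  by (simp add: adjacency_matrix_def)

lemma adjacency_index:
  "\<lbrakk>i < num_verts; j < num_verts\<rbrakk> \<Longrightarrow> adjacency_matrix G $$ (i, j)
    = of_nat (card {e \<in> arcs G. tail G e = vertex i \<and> head G e = vertex j})"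
  by (simp add: adjacency_matrix_def)

text \<open>Grouping the arcs by their heads turns multiplicities of parallel arcs into separate
  summands.\<close>

lemma adjacency_row_sum:
  fixes f :: "'a \<Rightarrow> complex"
  assumes "i < num_verts"
  shows "(\<Sum>j<num_verts. adjacency_matrix G $$ (i, j) * f (vertex j)) = (\<Sum>e\<in>out_arcs G (vertex i). f (head G e))"
proof -
  have "(\<Sum>j<num_verts. adjacency_matrix G $$ (i, j) * f (vertex j))
    = (\<Sum>j<num_verts. \<Sum>e | e \<in> out_arcs G (vertex i) \<and> head G e = vertex j. f (head G e))"
    using assms by (intro sum.cong) (auto simp: adjacency_index out_arcs_def conj_assoc)
  also have "\<dots> = (\<Sum>v\<in>verts G. \<Sum>e | e \<in> out_arcs G (vertex i) \<and> head G e = v. f (head G e))"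
    by (rule sum.reindex_bij_betw[OF vertex_bij])
  also have "\<dots> = (\<Sum>e\<in>out_arcs G (vertex i). f (head G e))"
    by (intro sum.group) auto
  finally show ?thesis .
qed

lemma adjacency_col_sum:
  assumes "j < num_verts"
  shows "(\<Sum>i<num_verts. adjacency_matrix G $$ (i, j)) = of_nat (in_degree G (vertex j))"
proof -
  have "(\<Sum>i<num_verts. adjacency_matrix G $$ (i, j))
    = (\<Sum>i<num_verts. \<Sum>e | e \<in> in_arcs G (vertex j) \<and> tail G e = vertex i. 1)"
  proof (intro sum.cong refl)
    fix i assume "i \<in> {..<num_verts}"
    moreover have "{e \<in> arcs G. tail G e = vertex i \<and> head G e = vertex j}
      = {e \<in> in_arcs G (vertex j). tail G e = vertex i}" by auto
    ultimately show "adjacency_matrix G $$ (i, j)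
      = (\<Sum>e | e \<in> in_arcs G (vertex j) \<and> tail G e = vertex i. 1)"
      using assms by (simp add: adjacency_index)
  qed
  also have "\<dots> = (\<Sum>v\<in>verts G. \<Sum>e | e \<in> in_arcs G (vertex j) \<and> tail G e = v. 1)"
    by (rule sum.reindex_bij_betw[OF vertex_bij])
  also have "\<dots> = (\<Sum>e\<in>in_arcs G (vertex j). 1)"
    by (intro sum.group) auto
  finally show ?thesis by (simp add: in_degree_def)
qed

lemma cmod_adjacency:
  "\<lbrakk>i < num_verts; j < num_verts\<rbrakk> \<Longrightarrow> complex_of_real (cmod (adjacency_matrix G $$ (i, j))) = adjacency_matrix G $$ (i, j)"
  by (simp add: adjacency_index)

lemma adjacency_abs_sums:
  assumes "regular_digraph k G"
  shows "abs_sums_le (real k) (adjacency_matrix G)"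
proof -
  let ?A = "adjacency_matrix G"
  have "(\<Sum>j<num_verts. cmod (?A $$ (i, j))) = real k" if "i < num_verts" for i
  proof -
    have "complex_of_real (\<Sum>j<num_verts. cmod (?A $$ (i, j))) = (\<Sum>j<num_verts. ?A $$ (i, j))"
      using that by (simp add: cmod_adjacency)
    also have "\<dots> = of_nat (out_degree G (vertex i))"
      using adjacency_row_sum[OF that, of "\<lambda>_. 1"] by (simp add: out_degree_def)
    also have "\<dots> = complex_of_real (real k)"
      using assms vertex_in_verts[OF that] by (simp add: regular_digraph_def)
    finally show ?thesis by (simp only: of_real_eq_iff)
  qed
  moreover have "(\<Sum>i<num_verts. cmod (?A $$ (i, j))) = real k" if "j < num_verts" for j
  proof -
    have "complex_of_real (\<Sum>i<num_verts. cmod (?A $$ (i, j))) = (\<Sum>i<num_verts. ?A $$ (i, j))"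
      using that by (simp add: cmod_adjacency)
    also have "\<dots> = complex_of_real (real k)"
      using assms vertex_in_verts[OF that] adjacency_col_sum[OF that] by (simp add: regular_digraph_def)
    finally show ?thesis by (simp only: of_real_eq_iff)
  qed
  ultimately show ?thesis using carrier_matD[OF adjacency_carrier] by (simp add: abs_sums_le_def)
qed

text \<open>Passes from vectors indexed by the enumeration to functions on vertices, on which walks
  can act.\<close>

lemma eigenvector_adjacencyE:
  assumes "eigenvector (adjacency_matrix G) v l"
  obtains f where "\<And>i. i < num_verts \<Longrightarrow> f (vertex i) = v $ i"
    and "\<And>u. u \<in> verts G \<Longrightarrow> (\<Sum>e\<in>out_arcs G u. f (head G e)) = l * f u"
    and "\<exists>u\<in>verts G. f u \<noteq> 0"
proof -
  let ?A = "adjacency_matrix G"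
  have v: "v \<in> carrier_vec num_verts" "v \<noteq> 0\<^sub>v num_verts" and Av: "?A *\<^sub>v v = l \<cdot>\<^sub>v v"
    using assms carrier_matD[OF adjacency_carrier] by (auto simp: eigenvector_def)
  define f where "f u = v $ (inv_into {..<num_verts} vertex u)" for u
  have f: "f (vertex i) = v $ i" if "i < num_verts" for i
    using that vertex_bij by (simp add: f_def bij_betw_inv_into_left)
  have "(\<Sum>e\<in>out_arcs G u. f (head G e)) = l * f u" if u: "u \<in> verts G" for u
  proof -
    obtain i where i: "i < num_verts" "u = vertex i" using u vertex_bij by (auto simp: bij_betw_def)
    have "(\<Sum>e\<in>out_arcs G u. f (head G e)) = (\<Sum>j<num_verts. ?A $$ (i, j) * f (vertex j))"
      unfolding i(2) by (rule adjacency_row_sum[OF i(1), symmetric])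
    also have "\<dots> = (?A *\<^sub>v v) $ i"
      using mult_mat_vec_index_sum[OF adjacency_carrier v(1) i(1)] by (simp add: f)
    also have "\<dots> = l * f u" unfolding Av using i v by (simp add: f)
    finally show ?thesis .
  qed
  moreover have "\<exists>u\<in>verts G. f u \<noteq> 0"
  proof (rule ccontr)
    assume "\<not> (\<exists>u\<in>verts G. f u \<noteq> 0)"
    then have "v = 0\<^sub>v num_verts" using v(1) f vertex_in_verts by (intro eq_vecI) (force simp: f[symmetric])+
    with v(2) show False by simp
  qed
  ultimately show ?thesis using that f by blast
qed

lemma eigenvalue_degree:
  assumes "out_regular k G" "0 < num_verts"
  shows "eigenvalue (adjacency_matrix G) (of_nat k)"
proof -
  let ?v = "vec num_verts (\<lambda>_. 1) :: complex vec"
  have "adjacency_matrix G *\<^sub>v ?v = of_nat k \<cdot>\<^sub>v ?v"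
  proof (rule eq_vecI)
    fix i assume "i < dim_vec (of_nat k \<cdot>\<^sub>v ?v)"
    then have i: "i < num_verts" by simp
    have "(adjacency_matrix G *\<^sub>v ?v) $ i = (\<Sum>j<num_verts. adjacency_matrix G $$ (i, j))"
      using mult_mat_vec_index_sum[OF adjacency_carrier _ i, of ?v] by simp
    also have "\<dots> = of_nat (out_degree G (vertex i))"
      using adjacency_row_sum[OF i, of "\<lambda>_. 1"] by (simp add: out_degree_def)
    also have "\<dots> = (of_nat k \<cdot>\<^sub>v ?v) $ i"
      using assms vertex_in_verts[OF i] i by (simp add: out_regular_def)
    finally show "(adjacency_matrix G *\<^sub>v ?v) $ i = (of_nat k \<cdot>\<^sub>v ?v) $ i" .
  qed (use carrier_matD[OF adjacency_carrier] in simp)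
  moreover have "?v \<noteq> 0\<^sub>v num_verts"
  proof
    assume "?v = 0\<^sub>v num_verts"
    from arg_cong[OF this, of "\<lambda>v. v $ 0"] show False using assms(2) by simp
  qed
  ultimately show ?thesis
    unfolding eigenvalue_def eigenvector_def carrier_matD[OF adjacency_carrier]
    by (intro exI[of _ ?v]) simp
qed

section \<open>Eigenvalues of modulus \<open>k\<close> on a strongly connected digraph\<close>

lemma peripheral_step:
  fixes f :: "'a \<Rightarrow> complex"
  assumes deg: "out_degree G u = k" "0 < k"
    and f: "(\<Sum>e\<in>out_arcs G u. f (head G e)) = l * f u" "cmod l = real k"
    and max: "\<And>w. w \<in> verts G \<Longrightarrow> cmod (f w) \<le> cmod (f u)"
    and e: "e \<in> out_arcs G u"
  shows "f (head G e) = (l / of_nat k) * f u"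
proof -
  let ?O = "out_arcs G u"
  define z where "z = (l / of_nat k) * f u"
  have z: "cmod z = cmod (f u)" unfolding z_def using f(2) deg(2) by (simp add: norm_mult norm_divide)
  \<comment> \<open>\<open>z\<close> is the mean of \<open>f\<close> over the out-neighbours and has maximal modulus, so the variance
    of \<open>f\<close> around \<open>z\<close> is at most \<open>0\<close>.\<close>
  have "(\<Sum>e\<in>?O. f (head G e)) = of_nat k * z" unfolding f(1) z_def using deg(2) by simp
  then have "(\<Sum>e\<in>?O. f (head G e) * cnj z) = of_nat k * (z * cnj z)"
    by (simp add: sum_distrib_right[symmetric])
  then have "(\<Sum>e\<in>?O. Re (f (head G e) * cnj z)) = real k * (cmod z)\<^sup>2"
    unfolding Re_sum[symmetric] complex_norm_square[symmetric] by (simp add: cmod_power2)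
  moreover have "(cmod (f (head G e) - z))\<^sup>2
      = (cmod (f (head G e)))\<^sup>2 - 2 * Re (f (head G e) * cnj z) + (cmod z)\<^sup>2" for e
    unfolding cmod_power2 by (simp add: power2_eq_square algebra_simps)
  ultimately have "(\<Sum>e\<in>?O. (cmod (f (head G e) - z))\<^sup>2)
    = (\<Sum>e\<in>?O. (cmod (f (head G e)))\<^sup>2) - real k * (cmod z)\<^sup>2"
    using deg(1) by (simp add: sum.distrib sum_subtractf sum_distrib_left[symmetric] out_degree_def)
  also have "(\<Sum>e\<in>?O. (cmod (f (head G e)))\<^sup>2) \<le> of_nat (card ?O) * (cmod z)\<^sup>2"
    unfolding z by (intro sum_bounded_above power_mono max) auto
  finally have "(\<Sum>e\<in>?O. (cmod (f (head G e) - z))\<^sup>2) \<le> 0"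
    using deg(1) by (simp add: out_degree_def)
  then have "(\<Sum>e\<in>?O. (cmod (f (head G e) - z))\<^sup>2) = 0"
    by (intro antisym sum_nonneg) auto
  then have "(cmod (f (head G e) - z))\<^sup>2 = 0" using e by (subst (asm) sum_nonneg_eq_0_iff) auto
  then show ?thesis by (simp add: z_def)
qed

text \<open>Starting at a vertex of maximal modulus, \<open>peripheral_step\<close> multiplies
  \<open>f\<close> by the unimodular factor \<open>l / k\<close> along each arc and so preserves
  maximality. Strong connectivity spreads maximality to all vertices, after which any walk can be
  used.\<close>

lemma peripheral_eigenfunction:
  fixes f :: "'a \<Rightarrow> complex"
  assumes reg: "out_regular k G" "0 < k" and sc: "strongly_connected G"
    and f: "\<And>u. u \<in> verts G \<Longrightarrow> (\<Sum>e\<in>out_arcs G u. f (head G e)) = l * f u"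
    and l: "cmod l = real k"
    and walk: "awalk u p w"
  shows "f w = (l / of_nat k) ^ length p * f u" and "\<exists>c. \<forall>v\<in>verts G. cmod (f v) = c"
proof -
  define m where "m = Max ((\<lambda>v. cmod (f v)) ` verts G)"
  have fin: "finite ((\<lambda>v. cmod (f v)) ` verts G)" "(\<lambda>v. cmod (f v)) ` verts G \<noteq> {}"
    using sc by (auto simp: strongly_connected_def)
  have le: "cmod (f v) \<le> m" if "v \<in> verts G" for v unfolding m_def using fin that by auto
  obtain v0 where v0: "v0 \<in> verts G" "cmod (f v0) = m" using Max_in[OF fin] unfolding m_def by auto
  have mu: "cmod (l / of_nat k) = 1" using l reg(2) by (simp add: norm_divide)
  have along: "awalk u p w \<Longrightarrow> cmod (f u) = m \<Longrightarrow> f w = (l / of_nat k) ^ length p * f u" for u p w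
  proof (induction p arbitrary: u)
    case Nil
    then show ?case by (simp add: awalk_Nil_iff)
  next
    case (Cons e es)
    then have e: "e \<in> arcs G" "u = tail G e" "awalk (head G e) es w" by (auto simp: awalk_Cons_iff)
    have u: "u \<in> verts G" using e by simp
    have step: "f (head G e) = (l / of_nat k) * f u"
      using reg u f[OF u] l le Cons.prems(2) e
      by (intro peripheral_step[of u k]) (auto simp: out_regular_def)
    then have "cmod (f (head G e)) = m" unfolding step norm_mult mu using Cons.prems(2) by simp
    from Cons.IH[OF e(3) this] show ?case unfolding step by simp
  qed
  have m: "cmod (f v) = m" if v: "v \<in> verts G" for v
  proof -
    obtain q where "awalk v0 q v" using sc v0 v by (auto simp: strongly_connected_def reachable_awalk)
    from along[OF this v0(2)] show ?thesis using v0(2) mu by (simp add: norm_mult norm_power)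
  qed
  then show "\<exists>c. \<forall>v\<in>verts G. cmod (f v) = c" by blast
  show "f w = (l / of_nat k) ^ length p * f u"
    using along[OF walk] m awalk_hd_in_verts[OF walk] by blast
qed

text \<open>Around a cycle \<open>f\<close> returns to the same value, which is nonzero as
  \<open>f\<close> has constant modulus and does not vanish everywhere. So \<open>l / k\<close>
  raised to any cycle length is \<open>1\<close>.\<close>

lemma peripheral_eigenvalue_power:
  assumes reg: "out_regular k G" "0 < k" and sc: "strongly_connected G"
    and ev: "eigenvector (adjacency_matrix G) v l" and l: "cmod l = real k"
  shows "(l / of_nat k) ^ period G = 1"
  unfolding period_def
proof (rule power_Gcd_eq_one)
  fix n assume "n \<in> {length p |p. cycle p}"
  then obtain p u where p: "awalk u p u" "n = length p" by (auto simp: cycle_def)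
  obtain f where f: "\<And>u. u \<in> verts G \<Longrightarrow> (\<Sum>e\<in>out_arcs G u. f (head G e)) = l * f u"
    and nz: "\<exists>u\<in>verts G. f u \<noteq> 0"
    using eigenvector_adjacencyE[OF ev] by metis
  note peripheral = peripheral_eigenfunction[OF reg sc f l p(1)]
  have "f u \<noteq> 0" using peripheral(2) nz awalk_hd_in_verts[OF p(1)] by (metis norm_eq_zero)
  then show "(l / of_nat k) ^ n = 1" using peripheral(1) p(2) by simp
qed

lemma perron_eigenvector_const:
  assumes reg: "out_regular k G" "0 < k" and sc: "strongly_connected G"
    and ev: "eigenvector (adjacency_matrix G) v (of_nat k)" and xy: "x < num_verts" "y < num_verts"
  shows "v $ x = v $ y"
proof -
  obtain f where f: "\<And>i. i < num_verts \<Longrightarrow> f (vertex i) = v $ i"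
    and eq: "\<And>u. u \<in> verts G \<Longrightarrow> (\<Sum>e\<in>out_arcs G u. f (head G e)) = of_nat k * f u"
    using eigenvector_adjacencyE[OF ev] by metis
  obtain p where "awalk (vertex x) p (vertex y)"
    using sc vertex_in_verts[OF xy(1)] vertex_in_verts[OF xy(2)]
    unfolding strongly_connected_def reachable_awalk by blast
  from peripheral_eigenfunction(1)[OF reg sc eq _ this] show ?thesis using reg(2) f xy by simp
qed

section \<open>From matrix powers to paths and distances\<close>

lemma walk_of_adjacency_power:
  "\<lbrakk>x < num_verts; y < num_verts; (adjacency_matrix G ^\<^sub>m m) $$ (x, y) \<noteq> 0\<rbrakk>
    \<Longrightarrow> \<exists>p. awalk (vertex x) p (vertex y) \<and> length p = m"
proof (induction m arbitrary: y)
  case 0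
  then have "x = y" using carrier_matD[OF adjacency_carrier] by (auto split: if_splits)
  then show ?case using vertex_in_verts[OF 0(1)] by (auto simp: awalk_Nil_iff)
next
  case (Suc m)
  let ?A = "adjacency_matrix G"
  have "\<exists>z<num_verts. (?A ^\<^sub>m m) $$ (x, z) * ?A $$ (z, y) \<noteq> 0"
    using Suc.prems(3) sum.neutral unfolding pow_mat_Suc_index[OF adjacency_carrier Suc.prems(1,2)]
    by (metis (no_types, lifting) lessThan_iff)
  then obtain z where z: "z < num_verts" "(?A ^\<^sub>m m) $$ (x, z) \<noteq> 0" "?A $$ (z, y) \<noteq> 0" by auto
  obtain p where p: "awalk (vertex x) p (vertex z)" "length p = m"
    using Suc.IH[OF Suc.prems(1) z(1,2)] by auto
  have "{e \<in> arcs G. tail G e = vertex z \<and> head G e = vertex y} \<noteq> {}"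
    using z(3) unfolding adjacency_index[OF z(1) Suc.prems(2)] by (metis card.empty of_nat_0)
  then obtain e where "e \<in> arcs G" "tail G e = vertex z" "head G e = vertex y" by auto
  with p have "awalk (vertex x) (p @ [e]) (vertex y)" "length (p @ [e]) = Suc m"
    using arc_implies_awalk[of e] by auto
  then show ?case by blast
qed

lemma awalk_to_shorter_apath:
  assumes "awalk u p v"
  shows "\<exists>q. apath u q v \<and> length q \<le> length p"
  using assms
proof (induction rule: awalk_to_apath_induct)
  case (path p)
  then show ?case by (auto simp: apath_def)
next
  case (decomp p q r s)
  obtain w where "p = q @ r @ s"
    using awalk_cyc_decompE[OF decomp(2,1,3)] by metis
  with decomp(4) show ?case by auto
qed

lemma path_withinI: "\<lbrakk>awalk u p v; real (length p) \<le> L\<rbrakk> \<Longrightarrow> path_within G L u v"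
  using awalk_to_shorter_apath unfolding path_within_def by fastforce

lemma path_within_mu_le: "\<lbrakk>path_within G L u v; path_within G L v w\<rbrakk> \<Longrightarrow> \<mu> (\<lambda>_. 1) u w \<le> ereal (2 * L)"
proof -
  assume "path_within G L u v" "path_within G L v w"
  then obtain p q where p: "awalk u p v" "real (length p) \<le> L" and q: "awalk v q w" "real (length q) \<le> L"
    unfolding path_within_def apath_def by auto
  have "\<mu> (\<lambda>_. 1) u w \<le> ereal (awalk_cost (\<lambda>_. 1) (p @ q))"
    using p(1) q(1) by (intro min_cost_le_walk_cost awalk_appendI)
  also have "awalk_cost (\<lambda>_. 1) (p @ q) = real (length p + length q)"
    by (simp add: awalk_cost_def sum_list_triv)
  also have "ereal \<dots> \<le> ereal (2 * L)" using p(2) q(2) by simp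
  finally show ?thesis .
qed

text \<open>The bad sets of \<open>u\<close> and \<open>w\<close> each cover less than half of the
  vertices, so some \<open>v\<close> is reached from \<open>u\<close> and reaches \<open>w\<close>
  within \<open>L\<close>.\<close>

lemma diam_le:
  assumes L: "\<And>x. x \<in> verts G \<Longrightarrow>
      2 * real (card {y \<in> verts G. \<not> (path_within G L x y \<and> path_within G L y x)}) < real num_verts"
  shows "diam G \<le> ereal (2 * L)"
  unfolding diam_def
proof (intro SUP_least)
  fix u w assume uw: "u \<in> verts G" "w \<in> verts G"
  let ?B = "\<lambda>x. {y \<in> verts G. \<not> (path_within G L x y \<and> path_within G L y x)}"
  have "card (?B u \<union> ?B w) \<le> card (?B u) + card (?B w)" by (rule card_Un_le)
  then have "card (?B u \<union> ?B w) < num_verts" using L[OF uw(1)] L[OF uw(2)] by linarith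
  then have "?B u \<union> ?B w \<noteq> verts G" by auto
  then obtain v where "path_within G L u v" "path_within G L v w" by auto
  then show "\<mu> (\<lambda>_. 1) u w \<le> ereal (2 * L)" by (rule path_within_mu_le)
qed

text \<open>With out-degree \<open>1\<close> no arc leaves the vertex set of a cycle, so by strong
  connectivity every cycle passes through all vertices.\<close>

lemma period_one_regular:
  assumes reg: "out_regular 1 G" and sc: "strongly_connected G" and per: "period G \<noteq> 0"
  shows "period G = num_verts"
proof -
  have len: "length p = num_verts" if cyc: "cycle p" for p
  proof -
    obtain u where p: "awalk u p u" "distinct (tl (awalk_verts u p))" "p \<noteq> []"
      using cyc unfolding cycle_def by auto
    have arcs: "set p \<subseteq> arcs G" using p(1) by (simp add: awalk_def)
    have verts: "set (tl (awalk_verts u p)) = head G ` set p"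
      using p awalk_verts_conv'[of u p u] by (auto simp: awalk_def)
    \<comment> \<open>The heads along a closed walk are a cyclic shift of the tails, so the two
      multisets agree.\<close>
    have tails: "tail G ` set p = head G ` set p"
    proof -
      have "map (tail G) p @ [head G (last p)] = tail G (hd p) # map (head G) p"
        using p(1,3) awalk_verts_conv[of u p] awalk_verts_conv'[of u p u] by (auto simp: awalk_def)
      moreover have "tail G (hd p) = u" "head G (last p) = u"
        using p(1,3) awalk_verts_conv[of u p] awlast_of_awalk awhd_of_awalk
        by (auto simp: hd_map hd_append dest: awhd_of_awalk)
      ultimately have "mset (map (tail G) p @ [u]) = mset (u # map (head G) p)" by simp
      then have "mset (map (tail G) p) = mset (map (head G) p)" by simp
      then show ?thesis by (metis set_map set_mset_mset)
    qed
    have closed: "head G e \<in> tail G ` set p" if e: "e \<in> arcs G" "tail G e \<in> tail G ` set p" for e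
    proof -
      obtain e' where e': "e' \<in> set p" "tail G e = tail G e'" using e(2) by auto
      have "card (out_arcs G (tail G e)) = 1"
        using reg e(1) by (simp add: out_regular_def out_degree_def)
      moreover have "e \<in> out_arcs G (tail G e)" "e' \<in> out_arcs G (tail G e)"
        using e(1) e' p(1) by auto
      ultimately have "e = e'" by (metis card_1_singletonE singletonD)
      then show ?thesis using e'(1) tails by auto
    qed
    have "awalk w q v \<Longrightarrow> w \<in> tail G ` set p \<Longrightarrow> v \<in> tail G ` set p" for w q v
      by (induction q arbitrary: w) (auto simp: awalk_Nil_iff awalk_Cons_iff closed)
    moreover have "tail G (hd p) \<in> tail G ` set p" "tail G (hd p) \<in> verts G"
      using hd_in_set[OF p(3)] arcs tail_in_verts by blast+
    ultimately have "verts G \<subseteq> tail G ` set p"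
      using sc unfolding strongly_connected_def reachable_awalk by blast
    moreover have "tail G ` set p \<subseteq> verts G" using arcs by auto
    ultimately have "verts G = set (tl (awalk_verts u p))" unfolding tails verts by (rule antisym)
    then have "num_verts = card (set (tl (awalk_verts u p)))" by (rule arg_cong)
    also have "\<dots> = length p" using distinct_card[OF p(2)] by (simp add: length_awalk_verts)
    finally show ?thesis by simp
  qed
  \<comment> \<open>The gcd of the empty set is \<open>0\<close>, which \<open>per\<close>
    excludes.\<close>
  have "\<exists>p. cycle p"
  proof (rule ccontr)
    assume "\<nexists>p. cycle p"
    then have "{length p |p. cycle p} = {}" by auto
    with per show False unfolding period_def by simp
  qed
  then have "{length p |p. cycle p} = {num_verts}" using len by (fastforce dest: len[symmetric])
  then show ?thesis unfolding period_def by simp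
qed

end

section \<open>Asymptotics\<close>

text \<open>The factor \<open>2\<close> comes from the union of the vertices missed from
  \<open>x\<close> and those missing \<open>x\<close>. The walks found have length below
  \<open>l + M\<close>, hence at most \<open>L\<close>.\<close>

lemma (in fin_digraph) card_unreached:
  assumes reg: "regular_digraph k G" and k: "2 \<le> k" and sc: "strongly_connected G"
    and ram: "ramanujan_digraph k G" and per: "period G = M" and M: "1 \<le> M"
    and normal: "r_normal r (adjacency_matrix G)"
    and L: "real l + real M \<le> L" and x: "x \<in> verts G"
  shows "real (card {y \<in> verts G. \<not> (path_within G L x y \<and> path_within G L y x)}) * real k ^ l
    \<le> 2 * ((real r)\<^sup>2 * real k ^ (r - 1) * (real l + real M) ^ (2 * (r - 1)) * (real num_verts)\<^sup>2)"
    (is "_ \<le> 2 * ?B")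
proof -
  let ?A = "adjacency_matrix G"
  have out: "out_regular k G" using ram by (simp add: ramanujan_digraph_def)
  have k0: "0 < k" using k by simp
  have n: "0 < num_verts" using x by (auto simp: card_gt_0_iff)
  obtain T U b where T: "similar_mat_wit ?A T U (mat_adjoint U)" "block_triangular r b T"
    using r_normal_triangularization[OF normal] .
  interpret triangularized_ramanujan ?A T U num_verts r M b "real k"
  proof
    show "cmod l \<le> sqrt (real k) \<or> cmod l = real k" if "eigenvalue ?A l" for l
      using ram that by (simp add: ramanujan_digraph_def)
    show "(l / complex_of_real (real k)) ^ M = 1" if "eigenvector ?A v l" "cmod l = real k" for v l
      using peripheral_eigenvalue_power[OF out k0 sc that] per by simp
    show "eigenvalue ?A (complex_of_real (real k))" using eigenvalue_degree[OF out n] by simp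
    show "v $ x = v $ y" if "eigenvector ?A v (complex_of_real (real k))" "x < num_verts" "y < num_verts" for v x y
      using perron_eigenvector_const[OF out k0 sc _ that(2,3)] that(1) by simp
  qed (use adjacency_carrier T adjacency_abs_sums[OF reg] k M in auto)
  obtain i where i: "i < num_verts" "x = vertex i"
    using x vertex_bij unfolding bij_betw_def by auto
  have within: "path_within G L (vertex y) (vertex z)"
    if "y < num_verts" "z < num_verts" "j < M" "(?A ^\<^sub>m (l + j)) $$ (y, z) \<noteq> 0" for y z j
    using walk_of_adjacency_power[OF that(1,2,4)] path_withinI that(3) L by fastforce
  let ?F = "{y. y < num_verts \<and> (\<forall>j<M. (?A ^\<^sub>m (l + j)) $$ (i, y) = 0)}"
  let ?T = "{y. y < num_verts \<and> (\<forall>j<M. (?A ^\<^sub>m (l + j)) $$ (y, i) = 0)}"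
  have "{y \<in> verts G. \<not> (path_within G L x y \<and> path_within G L y x)} \<subseteq> vertex ` (?F \<union> ?T)"
  proof
    fix y assume y: "y \<in> {y \<in> verts G. \<not> (path_within G L x y \<and> path_within G L y x)}"
    then obtain j where j: "j < num_verts" "y = vertex j"
      using vertex_bij unfolding bij_betw_def by auto
    then have "j \<in> ?F \<union> ?T" using y within[OF i(1) j(1)] within[OF j(1) i(1)] i(2) by auto
    then show "y \<in> vertex ` (?F \<union> ?T)" using j(2) by blast
  qed
  then have "card {y \<in> verts G. \<not> (path_within G L x y \<and> path_within G L y x)} \<le> card (?F \<union> ?T)"
    by (intro surj_card_le) auto
  also have "\<dots> \<le> card ?F + card ?T" by (rule card_Un_le)
  finally have "real (card {y \<in> verts G. \<not> (path_within G L x y \<and> path_within G L y x)}) * real k ^ l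
    \<le> (real (card ?F) + real (card ?T)) * real k ^ l"
    by (intro mult_right_mono) auto
  also have "\<dots> \<le> 2 * ?B"
    using card_unreached_from[OF i(1), of l] card_unreached_to[OF i(1), of l]
    by (simp add: distrib_right)
  finally show ?thesis .
qed

definition walk_length :: "nat \<Rightarrow> nat \<Rightarrow> nat \<Rightarrow> real" where
  "walk_length k r n = log (real k) (real n) + (2 * real r - 1) * log (real k) (ln (real n))"

text \<open>The factors up to \<open>k ^ (r - 1)\<close> come from \<open>card_unreached\<close>,
  the power of \<open>2 / ln k\<close> from the bound \<open>L \<le> 2 * ln n / ln k\<close>, and
  \<open>k ^ (M + 1)\<close> from replacing \<open>l\<close> by \<open>L - 1 - M\<close>.\<close>

definition unreached_const :: "nat \<Rightarrow> nat \<Rightarrow> nat \<Rightarrow> real" where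
  "unreached_const k M r = 2 * (real r)\<^sup>2 * real k ^ (r - 1) * (2 / ln (real k)) ^ (2 * (r - 1)) * real k ^ (M + 1)"

text \<open>Since \<open>k powr L = n * ln n ^ (2 * r - 1)\<close>, dividing the bound of order
  \<open>n\<^sup>2 * ln n ^ (2 * r - 2)\<close> by \<open>k ^ l\<close> leaves the order
  \<open>n / ln n\<close>.\<close>

lemma (in fin_digraph) card_unreached_walk_length:
  assumes reg: "regular_digraph k G" and k: "2 \<le> k" and sc: "strongly_connected G"
    and ram: "ramanujan_digraph k G" and per: "period G = M" and M: "1 \<le> M"
    and normal: "r_normal r (adjacency_matrix G)" and r: "1 \<le> r"
    and n1: "1 \<le> ln (real num_verts)" and nM: "real M * ln (real k) \<le> ln (real num_verts)"
    and nr: "(2 * real r - 1) * ln (ln (real num_verts)) \<le> ln (real num_verts)"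
    and x: "x \<in> verts G"
  defines "L \<equiv> walk_length k r num_verts"
  shows "real (card {y \<in> verts G. \<not> (path_within G L x y \<and> path_within G L y x)})
    \<le> unreached_const k M r * (real num_verts / ln (real num_verts))"
proof -
  define n where "n = real num_verts"
  \<comment> \<open>The window of walk lengths must end by \<open>L\<close>. Rounding and the window
    cost at most \<open>M + 1\<close> in the exponent; \<open>M \<le> L\<close> below ensures that
    the subtraction is not truncated.\<close>
  define l where "l = nat \<lfloor>L\<rfloor> - M"
  define c where "c = real (card {y \<in> verts G. \<not> (path_within G L x y \<and> path_within G L y x)})"
  have lnk: "0 < ln (real k)" and k0: "0 < real k" using k by auto
  have n0: "0 < n" and lnn: "1 \<le> ln n" "0 < ln n"
    using n1 unfolding n_def by (cases "num_verts = 0", auto)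
  have L_eq: "L = (ln n + (2 * real r - 1) * ln (ln n)) / ln (real k)"
    unfolding L_def walk_length_def n_def log_def by (simp add: add_divide_distrib)
  have "0 \<le> (2 * real r - 1) * ln (ln n)" using r lnn by simp
  then have "real M * ln (real k) \<le> ln n + (2 * real r - 1) * ln (ln n)"
    using nM unfolding n_def by linarith
  then have LM: "real M \<le> L" unfolding L_eq using lnk by (simp add: pos_le_divide_eq)
  then have floor: "M \<le> nat \<lfloor>L\<rfloor>" by (simp add: le_nat_floor)
  then have l: "real l + real M = real (nat \<lfloor>L\<rfloor>)" unfolding l_def by simp
  have lL: "real l + real M \<le> L" using l LM by simp
  have Ll: "L - 1 - real M \<le> real l" using l LM by linarith
  have L2: "L \<le> 2 / ln (real k) * ln n"
    unfolding L_eq using nr lnk by (simp add: divide_right_mono n_def)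
  have "real k powr L = n * ln n ^ (2 * r - 1)"
  proof -
    have "real k powr L = exp (ln n + (2 * real r - 1) * ln (ln n))"
      unfolding L_eq powr_def using lnk k0 by simp
    also have "\<dots> = n * exp (real (2 * r - 1) * ln (ln n))"
      using n0 r by (simp add: exp_add of_nat_diff)
    also have "\<dots> = n * ln n ^ (2 * r - 1)"
      using lnn by (simp add: exp_of_nat_mult)
    finally show ?thesis .
  qed
  moreover have "real k powr L = real k powr (L - 1 - real M) * real k powr (real (M + 1))"
    unfolding powr_add[symmetric] by simp
  ultimately have "n * ln n ^ (2 * r - 1) = real k powr (L - 1 - real M) * real k ^ (M + 1)"
    unfolding powr_realpow[OF k0] by simp
  also have "real k powr (L - 1 - real M) \<le> real k ^ l"
    using Ll k powr_mono[of "L - 1 - real M" "real l" "real k"] by (simp add: powr_realpow)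
  finally have kl: "n * ln n ^ (2 * r - 1) \<le> real k ^ l * real k ^ (M + 1)" using k0 by simp
  have "c * real k ^ l
    \<le> 2 * ((real r)\<^sup>2 * real k ^ (r - 1) * (real l + real M) ^ (2 * (r - 1)) * n\<^sup>2)"
    unfolding c_def n_def by (rule card_unreached[OF reg k sc ram per M normal lL x])
  also have "\<dots> \<le> 2 * ((real r)\<^sup>2 * real k ^ (r - 1) * (2 / ln (real k) * ln n) ^ (2 * (r - 1)) * n\<^sup>2)"
    using lL L2 by (intro mult_left_mono mult_right_mono power_mono) auto
  finally have ckl: "c * real k ^ l
    \<le> 2 * ((real r)\<^sup>2 * real k ^ (r - 1) * (2 / ln (real k) * ln n) ^ (2 * (r - 1)) * n\<^sup>2)" .
  have "c * (n * ln n ^ (2 * r - 1)) \<le> c * (real k ^ l * real k ^ (M + 1))"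
    using kl by (intro mult_left_mono) (auto simp: c_def)
  also have "\<dots> = (c * real k ^ l) * real k ^ (M + 1)" by simp
  also have "\<dots> \<le> 2 * ((real r)\<^sup>2 * real k ^ (r - 1) * (2 / ln (real k) * ln n) ^ (2 * (r - 1)) * n\<^sup>2)
      * real k ^ (M + 1)"
    using ckl by (rule mult_right_mono) simp
  also have "\<dots> = unreached_const k M r * (n / ln n) * (n * ln n ^ (2 * r - 1))"
  proof -
    \<comment> \<open>The one surplus factor \<open>ln n\<close> is what makes the number of missed
      vertices sublinear.\<close>
    have "2 * r - 1 = Suc (2 * (r - 1))" using r by simp
    then show ?thesis
      unfolding unreached_const_def power_mult_distrib using lnn by (simp add: power2_eq_square)
  qed
  finally show ?thesis
    using n0 lnn unfolding c_def[symmetric] n_def[symmetric]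
    by (subst (asm) mult_le_cancel_right_pos) auto
qed

lemma ln_nat_at_top: "filterlim (\<lambda>n. ln (real n)) at_top sequentially"
  by (rule filterlim_compose[OF ln_at_top filterlim_real_sequentially])

lemma div_ln_smallo: "(\<lambda>n. c * (real n / ln (real n))) \<in> o(\<lambda>n. real n)"
proof (rule smalloI_tendsto)
  have "((\<lambda>n. c / ln (real n)) \<longlongrightarrow> 0) sequentially"
    by (intro tendsto_divide_0[OF tendsto_const] filterlim_at_top_imp_at_infinity ln_nat_at_top)
  moreover have "\<forall>\<^sub>F n in sequentially. c / ln (real n) = c * (real n / ln (real n)) / real n"
    using eventually_gt_at_top[of 0] by eventually_elim simp
  ultimately show "((\<lambda>n. c * (real n / ln (real n)) / real n) \<longlongrightarrow> 0) sequentially"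
    by (rule Lim_transform_eventually)
  show "\<forall>\<^sub>F n in sequentially. real n \<noteq> 0"
    using eventually_gt_at_top[of 0] by eventually_elim simp
qed

lemma ln_ln_div_ln_tendsto: "((\<lambda>n. c * (ln (ln (real n)) / ln (real n))) \<longlongrightarrow> 0) sequentially"
  by (rule tendsto_mult_right_zero, rule filterlim_compose[OF ln_x_over_x_tendsto_0 ln_nat_at_top])

text \<open>The error functions are chosen before the graph and depend on \<open>n\<close> alone
  once \<open>k\<close>, \<open>M\<close>, \<open>r\<close> are fixed, so the asymptotics are
  uniform over all graphs and vertices.\<close>

theorem theorem2:
  fixes k M r :: nat
  assumes "k \<ge> 1" and "M \<ge> 1" and "r \<ge> 1"
  shows "\<exists>\<epsilon> \<delta> \<eta> :: nat \<Rightarrow> real.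
    \<epsilon> \<in> o(\<lambda>_. 1) \<and> \<delta> \<in> o(\<lambda>n. real n) \<and> \<eta> \<in> o(\<lambda>_. 1) \<and>
    (\<forall>\<^sub>F n in sequentially. \<forall>Y :: ('v, 'e) pre_digraph.
      fin_digraph Y \<and> card (verts Y) = n \<and>
      regular_digraph k Y \<and> strongly_connected Y \<and> ramanujan_digraph k Y \<and>
      period Y = M \<and> r_normal r (adjacency_matrix Y) \<longrightarrow>
      (let L = log (real k) (real n)
             + (2 * real r - 1 + \<epsilon> n) * log (real k) (ln (real n))
       in \<forall>x \<in> verts Y.
            real (card {y \<in> verts Y. \<not> (path_within Y L x y \<and> path_within Y L y x)}) \<le> \<delta> n) \<and>
      diam Y \<le> ereal ((2 + \<eta> n) * log (real k) (real n)))"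
proof (cases "k = 1")
  case True
  \<comment> \<open>For \<open>n > M\<close> the period, being \<open>n\<close>, cannot equal
    \<open>M\<close>; the claim is then vacuous and zero error functions suffice.\<close>
  have "\<forall>\<^sub>F n in sequentially. \<forall>Y :: ('v, 'e) pre_digraph.
      fin_digraph Y \<and> card (verts Y) = n \<and> regular_digraph k Y \<and> strongly_connected Y \<longrightarrow> period Y \<noteq> M"
    using eventually_gt_at_top[of M]
  proof eventually_elim
    case (elim n)
    have "period Y \<noteq> M"
      if Y: "fin_digraph Y" "card (verts Y) = n" "regular_digraph k Y" "strongly_connected Y"
      for Y :: "('v, 'e) pre_digraph"
    proof
      assume "period Y = M"
      moreover have "out_regular 1 Y" using Y(3) True by (simp add: regular_digraph_def out_regular_def)
      ultimately show False
        using fin_digraph.period_one_regular[OF Y(1) _ Y(4)] Y(2) elim assms(2) by simp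
    qed
    then show ?case by blast
  qed
  then show ?thesis
    by (intro exI[of _ "\<lambda>_. 0"] conjI) (auto elim!: eventually_mono)
next
  case False
  with assms have k: "2 \<le> k" by simp
  define \<delta> where "\<delta> n = unreached_const k M r * (real n / ln (real n))" for n
  \<comment> \<open>Solves \<open>(2 + \<eta> n) * log k n = 2 * walk_length k r n\<close>, the
    bound produced by \<open>diam_le\<close>.\<close>
  define \<eta> where "\<eta> n = (2 * (2 * real r - 1)) * (ln (ln (real n)) / ln (real n))" for n
  have lnk: "0 < ln (real k)" using k by simp
  have \<delta>: "\<delta> \<in> o(\<lambda>n. real n)" unfolding \<delta>_def by (rule div_ln_smallo)
  have \<eta>: "\<eta> \<in> o(\<lambda>_. 1)"
    unfolding \<eta>_def by (rule smalloI_tendsto) (use ln_ln_div_ln_tendsto in auto)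
  \<comment> \<open>Any constant below \<open>1 / 2\<close> would do: \<open>diam_le\<close> wants
    fewer than half of the vertices to be bad.\<close>
  have "\<forall>\<^sub>F n in sequentially. \<bar>\<delta> n\<bar> \<le> 1 / 3 * \<bar>real n\<bar>"
    using landau_o.smallD[OF \<delta>, of "1/3"] by simp
  moreover have "\<forall>\<^sub>F n in sequentially. max 1 (real M * ln (real k)) \<le> ln (real n)"
    using ln_nat_at_top unfolding filterlim_at_top by blast
  moreover have "\<forall>\<^sub>F n in sequentially. (2 * real r - 1) * (ln (ln (real n)) / ln (real n)) < 1"
    by (rule order_tendstoD(2)[OF ln_ln_div_ln_tendsto]) simp
  ultimately have "\<forall>\<^sub>F n in sequentially. \<forall>Y :: ('v, 'e) pre_digraph.
      fin_digraph Y \<and> card (verts Y) = n \<and>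
      regular_digraph k Y \<and> strongly_connected Y \<and> ramanujan_digraph k Y \<and>
      period Y = M \<and> r_normal r (adjacency_matrix Y) \<longrightarrow>
      (\<forall>x \<in> verts Y. real (card {y \<in> verts Y.
          \<not> (path_within Y (walk_length k r n) x y \<and> path_within Y (walk_length k r n) y x)}) \<le> \<delta> n) \<and>
      diam Y \<le> ereal ((2 + \<eta> n) * log (real k) (real n))"
  proof eventually_elim
    case (elim n)
    then have ln1: "1 \<le> ln (real n)" "real M * ln (real k) \<le> ln (real n)" by auto
    then have n: "0 < n" by (cases n) auto
    have nr: "(2 * real r - 1) * ln (ln (real n)) \<le> ln (real n)"
      using elim(3) ln1(1) by (simp add: field_simps)
    have eq: "(2 + \<eta> n) * log (real k) (real n) = 2 * walk_length k r n"
      unfolding walk_length_def \<eta>_def log_def using ln1(1) lnk by (simp add: field_simps)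
    have main: "(\<forall>x \<in> verts Y. real (card {y \<in> verts Y.
          \<not> (path_within Y (walk_length k r n) x y \<and> path_within Y (walk_length k r n) y x)}) \<le> \<delta> n)
        \<and> diam Y \<le> ereal (2 * walk_length k r n)"
      if fin: "fin_digraph Y" and Y: "card (verts Y) = n"
        "regular_digraph k Y" "strongly_connected Y" "ramanujan_digraph k Y"
        "period Y = M" "r_normal r (adjacency_matrix Y)"
      for Y :: "('v, 'e) pre_digraph"
    proof -
      interpret fin_digraph Y by (rule fin)
      have bound: "real (card {y \<in> verts Y.
          \<not> (path_within Y (walk_length k r n) x y \<and> path_within Y (walk_length k r n) y x)}) \<le> \<delta> n"
        if "x \<in> verts Y" for x
        using card_unreached_walk_length[OF Y(2) k Y(3-5) assms(2) Y(6) assms(3)] that ln1 nr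
        unfolding Y(1) \<delta>_def by blast
      have "diam Y \<le> ereal (2 * walk_length k r n)"
      proof (rule diam_le)
        fix x assume "x \<in> verts Y"
        from bound[OF this] show "2 * real (card {y \<in> verts Y.
          \<not> (path_within Y (walk_length k r n) x y \<and> path_within Y (walk_length k r n) y x)})
          < real (card (verts Y))"
          unfolding Y(1) using elim(1) n by linarith
      qed
      with bound show ?thesis by blast
    qed
    show ?case unfolding eq by (intro allI impI, elim conjE) (rule main)
  qed
  then show ?thesis
    \<comment> \<open>The choice \<open>\<epsilon> = 0\<close> works because all constant factors,
      including the loss from rounding, are absorbed into \<open>\<delta>\<close>.\<close>
    using \<delta> \<eta> by (intro exI[of _ "\<lambda>_. 0"] exI[of _ \<delta>] exI[of _ \<eta>])
      (simp add: walk_length_def Let_def)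
qed

end
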